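(* Let $R=\begin{pmatrix} A & M\\ N & B\end{pmatrix}$ be a Morita context ring such that $MN$ and $NM$ are nilpotent ideals of $A$ and $B$, respectively. Then $R$ is GSNC if and only if both $A$ and $B$ are strongly nil-clean.
   Context: Rings are associative with identity, not necessarily commutative. A Morita context consists of rings $A,B$, an $(A,B)$-bimodule $M$, a $(B,A)$-bimodule $N$, and bimodule homomorphisms $\phi:M\otimes_B N\to A$ and $\psi:N\otimes_A M\to B$; write $mn:=\phi(m\otimes n)$ and $nm:=\psi(n\otimes m)$. These satisfy $(mn)m'=m(nm')$ and $(nm)n'=n(mn')$ for all $m,m'\in M$, $n,n'\in N$. The set of matrices $\begin{pmatrix} a & m\\ n& b\end{pmatrix}$ with $a\in A$, $m\in M$, $n\in N$, $b\in B$ is then an associative ring under the obvious matrix operations, called the Morita context ring. The trace ideals are $MN:=\operatorname{Im}\phi\subseteq A$ and $NM:=\operatorname{Im}\psi\subseteq B$. An element $a$ of a ring is strongly nil-clean if $a=e+q$ with $e$ idempotent, $q$ nilpotent and $eq=qe$. A ring is strongly nil-clean if every element is strongly nil-clean, and generalized strongly nil-clean (GSNC) if every non-invertible element is strongly nil-clean.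
   Formalization: The rings A and B are assumed to be nonzero (1 ≠ 0); without this the statement fails, for example for A the field with three elements and B = M = N = 0, where R ≅ A is GSNC but A is not strongly nil-clean. *)

theory Defs
  imports "HOL-Algebra.Algebra"
begin

section \<open>Bimodules over non-commutative rings\<close>

text \<open>The locale \<^locale>\<open>module\<close> requires a commutative ring of scalars. As for the library's
  modules, the multiplicative fields of the underlying ring record play no role.\<close>

record ('a, 'b, 'm) bimodule = "('a, 'm) module" +
  rsmult :: "['m, 'b] \<Rightarrow> 'm" (infixl \<open>\<odot>r\<index>\<close> 70)

locale bimodule = A: ring A + B: ring B + M: abelian_group M
  for A :: "('a, 'x) ring_scheme" and B :: "('b, 'y) ring_scheme"
    and M :: "('a, 'b, 'm) bimodule" +
  assumes lsmult_closed [simp, intro]: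
      "\<lbrakk>a \<in> carrier A; x \<in> carrier M\<rbrakk> \<Longrightarrow> a \<odot>\<^bsub>M\<^esub> x \<in> carrier M"
    and lsmult_l_distr:
      "\<lbrakk>a \<in> carrier A; a' \<in> carrier A; x \<in> carrier M\<rbrakk>
        \<Longrightarrow> (a \<oplus>\<^bsub>A\<^esub> a') \<odot>\<^bsub>M\<^esub> x = a \<odot>\<^bsub>M\<^esub> x \<oplus>\<^bsub>M\<^esub> a' \<odot>\<^bsub>M\<^esub> x"
    and lsmult_r_distr:
      "\<lbrakk>a \<in> carrier A; x \<in> carrier M; y \<in> carrier M\<rbrakk>
        \<Longrightarrow> a \<odot>\<^bsub>M\<^esub> (x \<oplus>\<^bsub>M\<^esub> y) = a \<odot>\<^bsub>M\<^esub> x \<oplus>\<^bsub>M\<^esub> a \<odot>\<^bsub>M\<^esub> y"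
    and lsmult_assoc:
      "\<lbrakk>a \<in> carrier A; a' \<in> carrier A; x \<in> carrier M\<rbrakk>
        \<Longrightarrow> (a \<otimes>\<^bsub>A\<^esub> a') \<odot>\<^bsub>M\<^esub> x = a \<odot>\<^bsub>M\<^esub> (a' \<odot>\<^bsub>M\<^esub> x)"
    and lsmult_one [simp]:
      "x \<in> carrier M \<Longrightarrow> \<one>\<^bsub>A\<^esub> \<odot>\<^bsub>M\<^esub> x = x"
    and rsmult_closed [simp, intro]:
      "\<lbrakk>x \<in> carrier M; b \<in> carrier B\<rbrakk> \<Longrightarrow> x \<odot>r\<^bsub>M\<^esub> b \<in> carrier M"
    and rsmult_r_distr:
      "\<lbrakk>x \<in> carrier M; b \<in> carrier B; b' \<in> carrier B\<rbrakk>
        \<Longrightarrow> x \<odot>r\<^bsub>M\<^esub> (b \<oplus>\<^bsub>B\<^esub> b') = x \<odot>r\<^bsub>M\<^esub> b \<oplus>\<^bsub>M\<^esub> x \<odot>r\<^bsub>M\<^esub> b'"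
    and rsmult_l_distr:
      "\<lbrakk>x \<in> carrier M; y \<in> carrier M; b \<in> carrier B\<rbrakk>
        \<Longrightarrow> (x \<oplus>\<^bsub>M\<^esub> y) \<odot>r\<^bsub>M\<^esub> b = x \<odot>r\<^bsub>M\<^esub> b \<oplus>\<^bsub>M\<^esub> y \<odot>r\<^bsub>M\<^esub> b"
    and rsmult_assoc:
      "\<lbrakk>x \<in> carrier M; b \<in> carrier B; b' \<in> carrier B\<rbrakk>
        \<Longrightarrow> x \<odot>r\<^bsub>M\<^esub> (b \<otimes>\<^bsub>B\<^esub> b') = (x \<odot>r\<^bsub>M\<^esub> b) \<odot>r\<^bsub>M\<^esub> b'"
    and rsmult_one [simp]:
      "x \<in> carrier M \<Longrightarrow> x \<odot>r\<^bsub>M\<^esub> \<one>\<^bsub>B\<^esub> = x"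
    and smult_compat:
      "\<lbrakk>a \<in> carrier A; x \<in> carrier M; b \<in> carrier B\<rbrakk>
        \<Longrightarrow> (a \<odot>\<^bsub>M\<^esub> x) \<odot>r\<^bsub>M\<^esub> b = a \<odot>\<^bsub>M\<^esub> (x \<odot>r\<^bsub>M\<^esub> b)"

definition bimodule_hom ::
  "('a, 'x) ring_scheme \<Rightarrow> ('b, 'y) ring_scheme
    \<Rightarrow> ('a, 'b, 'm) bimodule \<Rightarrow> ('a, 'b, 'n) bimodule \<Rightarrow> ('m \<Rightarrow> 'n) set" where
  "bimodule_hom A B M N =
    {f \<in> hom (add_monoid M) (add_monoid N).
      (\<forall>a\<in>carrier A. \<forall>x\<in>carrier M. f (a \<odot>\<^bsub>M\<^esub> x) = a \<odot>\<^bsub>N\<^esub> f x) \<and>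
      (\<forall>x\<in>carrier M. \<forall>b\<in>carrier B. f (x \<odot>r\<^bsub>M\<^esub> b) = f x \<odot>r\<^bsub>N\<^esub> b)}"

definition regular_bimodule :: "('a, 'x) ring_scheme \<Rightarrow> ('a, 'a, 'a) bimodule" where
  "regular_bimodule A =
    \<lparr>carrier = carrier A, monoid.mult = monoid.mult A, one = \<one>\<^bsub>A\<^esub>, ring.zero = \<zero>\<^bsub>A\<^esub>, ring.add = ring.add A,
     smult = monoid.mult A, rsmult = monoid.mult A\<rparr>"


section \<open>Tensor products of bimodules\<close>

text \<open>The tensor product over \<open>B\<close> is the free abelian group on pairs, modulo the subgroup
  generated by the relations making the tensor sign biadditive and \<open>B\<close>-balanced.\<close>

definition tensor_free ::
  "('a, 'b, 'm) bimodule \<Rightarrow> ('b, 'c, 'n) bimodule \<Rightarrow> ('m \<times> 'n \<Rightarrow>\<^sub>0 int) monoid" where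
  "tensor_free M N = free_Abelian_group (carrier M \<times> carrier N)"

definition tensor_relators ::
  "('b, 'x) ring_scheme \<Rightarrow> ('a, 'b, 'm) bimodule \<Rightarrow> ('b, 'c, 'n) bimodule
    \<Rightarrow> ('m \<times> 'n \<Rightarrow>\<^sub>0 int) set" where
  "tensor_relators B M N =
    {frag_of (x \<oplus>\<^bsub>M\<^esub> x', y) - frag_of (x, y) - frag_of (x', y) | x x' y.
        x \<in> carrier M \<and> x' \<in> carrier M \<and> y \<in> carrier N} \<union>
    {frag_of (x, y \<oplus>\<^bsub>N\<^esub> y') - frag_of (x, y) - frag_of (x, y') | x y y'.
        x \<in> carrier M \<and> y \<in> carrier N \<and> y' \<in> carrier N} \<union>
    {frag_of (x \<odot>r\<^bsub>M\<^esub> b, y) - frag_of (x, b \<odot>\<^bsub>N\<^esub> y) | x b y.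
        x \<in> carrier M \<and> b \<in> carrier B \<and> y \<in> carrier N}"

definition tensor_kernel ::
  "('b, 'x) ring_scheme \<Rightarrow> ('a, 'b, 'm) bimodule \<Rightarrow> ('b, 'c, 'n) bimodule
    \<Rightarrow> ('m \<times> 'n \<Rightarrow>\<^sub>0 int) set" where
  "tensor_kernel B M N = generate (tensor_free M N) (tensor_relators B M N)"

definition pure_tensor ::
  "('b, 'x) ring_scheme \<Rightarrow> ('a, 'b, 'm) bimodule \<Rightarrow> ('b, 'c, 'n) bimodule
    \<Rightarrow> 'm \<Rightarrow> 'n \<Rightarrow> ('m \<times> 'n \<Rightarrow>\<^sub>0 int) set" where
  "pure_tensor B M N x y = tensor_kernel B M N #>\<^bsub>tensor_free M N\<^esub> frag_of (x, y)"

text \<open>A scalar acts on a coset through the additive extension, to all representatives, of its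
  action on pairs. The union below runs over the representatives \<open>t\<close> of the coset \<open>T\<close>, which all
  contribute the same coset.\<close>

definition tensor_product ::
  "('b, 'x) ring_scheme \<Rightarrow> ('a, 'b, 'm) bimodule \<Rightarrow> ('b, 'c, 'n) bimodule
    \<Rightarrow> ('a, 'c, ('m \<times> 'n \<Rightarrow>\<^sub>0 int) set) bimodule" where
  "tensor_product B M N =
    (let F = tensor_free M N; K = tensor_kernel B M N in
     \<lparr>carrier = carrier (F Mod K),
      monoid.mult = undefined, one = undefined,
      ring.zero = \<one>\<^bsub>F Mod K\<^esub>,
      ring.add = monoid.mult (F Mod K),
      smult = (\<lambda>a T. \<Union>t\<in>T. K #>\<^bsub>F\<^esub> frag_extend (\<lambda>(x, y). frag_of (a \<odot>\<^bsub>M\<^esub> x, y)) t),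
      rsmult = (\<lambda>T c. \<Union>t\<in>T. K #>\<^bsub>F\<^esub> frag_extend (\<lambda>(x, y). frag_of (x, y \<odot>r\<^bsub>N\<^esub> c)) t)\<rparr>)"


section \<open>Morita contexts\<close>

locale morita_context =
  M: bimodule A B M + N: bimodule B A N
  for A :: "('a, 'x) ring_scheme" and B :: "('b, 'y) ring_scheme"
    and M :: "('a, 'b, 'm) bimodule" and N :: "('b, 'a, 'n) bimodule"
    and \<phi> :: "('m \<times> 'n \<Rightarrow>\<^sub>0 int) set \<Rightarrow> 'a" and \<psi> :: "('n \<times> 'm \<Rightarrow>\<^sub>0 int) set \<Rightarrow> 'b" +
  assumes \<phi>_hom: "\<phi> \<in> bimodule_hom A A (tensor_product B M N) (regular_bimodule A)"
    and \<psi>_hom: "\<psi> \<in> bimodule_hom B B (tensor_product A N M) (regular_bimodule B)"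
    and M_assoc: "\<lbrakk>m \<in> carrier M; n \<in> carrier N; m' \<in> carrier M\<rbrakk>
      \<Longrightarrow> \<phi> (pure_tensor B M N m n) \<odot>\<^bsub>M\<^esub> m' = m \<odot>r\<^bsub>M\<^esub> \<psi> (pure_tensor A N M n m')"
    and N_assoc: "\<lbrakk>n \<in> carrier N; m \<in> carrier M; n' \<in> carrier N\<rbrakk>
      \<Longrightarrow> \<psi> (pure_tensor A N M n m) \<odot>\<^bsub>N\<^esub> n' = n \<odot>r\<^bsub>N\<^esub> \<phi> (pure_tensor B M N m n')"

text \<open>The tuple \<open>(a, m, n, b)\<close> stands for the matrix with rows \<open>a, m\<close> and \<open>n, b\<close>.\<close>

definition morita_ring ::
  "('a, 'x) ring_scheme \<Rightarrow> ('b, 'y) ring_scheme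
    \<Rightarrow> ('a, 'b, 'm) bimodule \<Rightarrow> ('b, 'a, 'n) bimodule
    \<Rightarrow> (('m \<times> 'n \<Rightarrow>\<^sub>0 int) set \<Rightarrow> 'a) \<Rightarrow> (('n \<times> 'm \<Rightarrow>\<^sub>0 int) set \<Rightarrow> 'b)
    \<Rightarrow> ('a \<times> 'm \<times> 'n \<times> 'b) ring" where
  "morita_ring A B M N \<phi> \<psi> =
    \<lparr>carrier = carrier A \<times> carrier M \<times> carrier N \<times> carrier B,
     monoid.mult = (\<lambda>(a, m, n, b) (a', m', n', b').
       (a \<otimes>\<^bsub>A\<^esub> a' \<oplus>\<^bsub>A\<^esub> \<phi> (pure_tensor B M N m n'),
        a \<odot>\<^bsub>M\<^esub> m' \<oplus>\<^bsub>M\<^esub> m \<odot>r\<^bsub>M\<^esub> b',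
        n \<odot>r\<^bsub>N\<^esub> a' \<oplus>\<^bsub>N\<^esub> b \<odot>\<^bsub>N\<^esub> n',
        \<psi> (pure_tensor A N M n m') \<oplus>\<^bsub>B\<^esub> b \<otimes>\<^bsub>B\<^esub> b')),
     one = (\<one>\<^bsub>A\<^esub>, \<zero>\<^bsub>M\<^esub>, \<zero>\<^bsub>N\<^esub>, \<one>\<^bsub>B\<^esub>),
     ring.zero = (\<zero>\<^bsub>A\<^esub>, \<zero>\<^bsub>M\<^esub>, \<zero>\<^bsub>N\<^esub>, \<zero>\<^bsub>B\<^esub>),
     ring.add = (\<lambda>(a, m, n, b) (a', m', n', b').
       (a \<oplus>\<^bsub>A\<^esub> a', m \<oplus>\<^bsub>M\<^esub> m', n \<oplus>\<^bsub>N\<^esub> n', b \<oplus>\<^bsub>B\<^esub> b'))\<rparr>"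

definition trace_ideal ::
  "('b, 'y) ring_scheme \<Rightarrow> ('a, 'b, 'm) bimodule \<Rightarrow> ('b, 'a, 'n) bimodule
    \<Rightarrow> (('m \<times> 'n \<Rightarrow>\<^sub>0 int) set \<Rightarrow> 'a) \<Rightarrow> 'a set" where
  "trace_ideal B M N \<phi> = \<phi> ` carrier (tensor_product B M N)"


section \<open>Nilpotent ideals and strongly nil-clean rings\<close>

primrec ideal_power :: "('a, 'x) ring_scheme \<Rightarrow> 'a set \<Rightarrow> nat \<Rightarrow> 'a set" where
  "ideal_power R I 0 = carrier R"
| "ideal_power R I (Suc k) = ideal_prod R (ideal_power R I k) I"

definition nilpotent_ideal :: "'a set \<Rightarrow> ('a, 'x) ring_scheme \<Rightarrow> bool" where
  "nilpotent_ideal I R \<longleftrightarrow> ideal I R \<and> (\<exists>k. ideal_power R I k = {\<zero>\<^bsub>R\<^esub>})"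

definition idempotent_elem :: "('a, 'x) ring_scheme \<Rightarrow> 'a \<Rightarrow> bool" where
  "idempotent_elem R e \<longleftrightarrow> e \<in> carrier R \<and> e \<otimes>\<^bsub>R\<^esub> e = e"

definition nilpotent_elem :: "('a, 'x) ring_scheme \<Rightarrow> 'a \<Rightarrow> bool" where
  "nilpotent_elem R q \<longleftrightarrow> q \<in> carrier R \<and> (\<exists>k::nat. q [^]\<^bsub>R\<^esub> k = \<zero>\<^bsub>R\<^esub>)"

definition strongly_nil_clean_elem :: "('a, 'x) ring_scheme \<Rightarrow> 'a \<Rightarrow> bool" where
  "strongly_nil_clean_elem R a \<longleftrightarrow>
    (\<exists>e q. idempotent_elem R e \<and> nilpotent_elem R q \<and>
           a = e \<oplus>\<^bsub>R\<^esub> q \<and> e \<otimes>\<^bsub>R\<^esub> q = q \<otimes>\<^bsub>R\<^esub> e)"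

definition strongly_nil_clean_ring :: "('a, 'x) ring_scheme \<Rightarrow> bool" where
  "strongly_nil_clean_ring R \<longleftrightarrow> ring R \<and> (\<forall>a\<in>carrier R. strongly_nil_clean_elem R a)"

definition gsnc_ring :: "('a, 'x) ring_scheme \<Rightarrow> bool" where
  "gsnc_ring R \<longleftrightarrow> ring R \<and> (\<forall>a\<in>carrier R - Units R. strongly_nil_clean_elem R a)"

end

(* An element a of a ring is strongly nil-clean iff a - a^2 is nilpotent: if a = e + q then
   a - a^2 = q (1 - 2e - q), and conversely an idempotent close to a is found by iterating
   c |-> 3c^2 - 2c^3 inside the commutative bicommutant of a, each step squaring c - c^2 up to a factor.

   If A and B are strongly nil-clean and r is a matrix with diagonal a, b, then a power of r - r^2
   has its diagonal in MN and NM, because modulo the trace ideals the diagonal entries are multiplied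
   as in A x B. A matrix with diagonal in the nilpotent trace ideals is nilpotent, since multiplying a
   row by it twice moves the row one step down the filtration by the powers of MN (or NM).

   Conversely diag(a, 0) and diag(0, b) are never units, so they are strongly nil-clean, and this
   property passes to the diagonal entries. *)
theory Submission
  imports Defs
begin

section \<open>Strong nil-cleanness as a nilpotency condition on
  \<open>a \<ominus> a \<otimes> a\<close>, and congruences modulo ideals\<close>

section \<open>Strongly nil-clean elements\<close>

context ring begin

text \<open>The double centralizer of \<open>a\<close>: a commutative subring containing
  \<open>a\<close>, so idempotents can be lifted there by arguments for \<open>cring\<close>, and
  whatever the lifting produces commutes automatically.\<close>

definition bicommutant :: "'a \<Rightarrow> 'a set" where
  "bicommutant a = {x \<in> carrier R. \<forall>y\<in>carrier R. y \<otimes> a = a \<otimes> y \<longrightarrow> x \<otimes> y = y \<otimes> x}"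

lemma bicommutant_carrier: "x \<in> bicommutant a \<Longrightarrow> x \<in> carrier R"
  unfolding bicommutant_def by blast

lemma bicommutant_comm:
  "\<lbrakk>x \<in> bicommutant a; y \<in> carrier R; y \<otimes> a = a \<otimes> y\<rbrakk> \<Longrightarrow> x \<otimes> y = y \<otimes> x"
  unfolding bicommutant_def by blast

lemma bicommutantI:
  assumes "x \<in> carrier R"
    and "\<And>y. y \<in> carrier R \<Longrightarrow> y \<otimes> a = a \<otimes> y \<Longrightarrow> x \<otimes> y = y \<otimes> x"
  shows "x \<in> bicommutant a"
  using assms unfolding bicommutant_def by blast

lemma bicommutant_self: "a \<in> carrier R \<Longrightarrow> a \<in> bicommutant a"
  by (rule bicommutantI) (simp_all only:)

text \<open>Commutativity comes from \<open>a\<close> commuting with itself: any \<open>h'\<close>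
  in the bicommutant therefore commutes with \<open>a\<close>, and so any \<open>h\<close> in the
  bicommutant commutes with \<open>h'\<close>.\<close>

lemma bicommutant_subcring:
  assumes a: "a \<in> carrier R"
  shows "subcring (bicommutant a) R"
proof (intro subcringI subringI)
  show "bicommutant a \<subseteq> carrier R" "\<one> \<in> bicommutant a"
    by (auto intro: bicommutantI dest: bicommutant_carrier)
next
  fix h assume h: "h \<in> bicommutant a"
  have "\<ominus> h \<otimes> y = y \<otimes> \<ominus> h" if "y \<in> carrier R" "y \<otimes> a = a \<otimes> y" for y
    using that(1) bicommutant_comm[OF h that] bicommutant_carrier[OF h] by (simp add: l_minus r_minus)
  then show "\<ominus> h \<in> bicommutant a"
    using h bicommutant_carrier by (blast intro: bicommutantI)
next
  fix h h' assume h: "h \<in> bicommutant a" "h' \<in> bicommutant a"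
  have car: "h \<in> carrier R" "h' \<in> carrier R" using h bicommutant_carrier by blast+
  show "h \<otimes> h' = h' \<otimes> h"
    using bicommutant_comm[OF h(1) car(2)] bicommutant_comm[OF h(2) a] by blast
  show "h \<oplus> h' \<in> bicommutant a"
  proof (rule bicommutantI)
    fix y assume y: "y \<in> carrier R" "y \<otimes> a = a \<otimes> y"
    then show "(h \<oplus> h') \<otimes> y = y \<otimes> (h \<oplus> h')"
      using car bicommutant_comm[OF h(1) y] bicommutant_comm[OF h(2) y] by (simp add: l_distr r_distr)
  qed (simp add: car)
  show "h \<otimes> h' \<in> bicommutant a"
  proof (rule bicommutantI)
    fix y assume y: "y \<in> carrier R" "y \<otimes> a = a \<otimes> y"
    have "h \<otimes> h' \<otimes> y = h \<otimes> (y \<otimes> h')"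
      using car y(1) bicommutant_comm[OF h(2) y] by (simp add: m_assoc)
    also have "\<dots> = y \<otimes> h \<otimes> h'"
      unfolding bicommutant_comm[OF h(1) y, symmetric] using car y(1) by (simp add: m_assoc)
    finally show "h \<otimes> h' \<otimes> y = y \<otimes> (h \<otimes> h')" using car y(1) by (simp add: m_assoc)
  qed (simp add: car)
qed

end

text \<open>Here c' = 3c^2 - 2c^3, written with d = 1 - c so that the symmetry between c and d is
  visible. In the expansion of 1 = (c + d)^3 it is the part c^3 + 3c^2 d; the remaining part is the
  same expression with c and d exchanged, so the product of the two is divisible by (cd)^2 =
  x^2.\<close>

lemma (in cring) idempotent_lift_step:
  assumes c: "c \<in> carrier R"
  defines "d \<equiv> \<one> \<ominus> c" and "x \<equiv> c \<ominus> c \<otimes> c"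
  defines "c' \<equiv> c \<otimes> c \<otimes> (\<one> \<oplus> d \<oplus> d)"
  shows "c = c' \<oplus> x \<otimes> (\<one> \<ominus> c \<ominus> c)"
    and "c' \<ominus> c' \<otimes> c' = (x \<otimes> x) \<otimes> ((\<one> \<oplus> d \<oplus> d) \<otimes> (\<one> \<oplus> c \<oplus> c))"
proof -
  have d: "d \<in> carrier R" using c by (simp add: d_def)
  have c': "c' \<in> carrier R" using c d by (simp add: c'_def)
  have cd: "c \<oplus> d = \<one>" using c unfolding d_def by algebra
  have x: "x = c \<otimes> d" using c by (simp add: x_def d_def minus_eq r_distr r_minus)
  let ?g = "c \<otimes> (c \<otimes> d)"
  have g: "?g \<in> carrier R" using c d by simp
  have c'_eq: "c' = c \<otimes> c \<oplus> (?g \<oplus> ?g)"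
    using c d by (simp add: c'_def r_distr a_assoc m_assoc)
  have "x \<otimes> (\<one> \<ominus> c \<ominus> c) = x \<ominus> (?g \<oplus> ?g)"
    using c d by (simp add: x minus_eq r_distr r_minus minus_add a_assoc m_ac)
  then have "c' \<oplus> x \<otimes> (\<one> \<ominus> c \<ominus> c) = c \<otimes> c \<oplus> (?g \<oplus> ?g) \<oplus> (c \<ominus> c \<otimes> c \<ominus> (?g \<oplus> ?g))"
    by (simp add: c'_eq x_def)
  also have "\<dots> = c"
  proof -
    have "u \<oplus> v \<oplus> (c \<ominus> u \<ominus> v) = c" if "u \<in> carrier R" "v \<in> carrier R" for u v
      using c that by algebra
    then show ?thesis using c g by simp
  qed
  finally show "c = c' \<oplus> x \<otimes> (\<one> \<ominus> c \<ominus> c)" by simp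
  \<comment> \<open>The mirror image of \<open>c'\<close> under exchanging \<open>c\<close> and
    \<open>d\<close>; it turns out to be the complement 1 - c'.\<close>
  define f where "f = d \<otimes> d \<otimes> (\<one> \<oplus> c \<oplus> c)"
  have f: "f \<in> carrier R" using c d by (simp add: f_def)
  \<comment> \<open>Multiplying cd by c + d = 1 raises its degree, which turns c^2 + 2cd + d^2 = 1
    into c' + f = 1.\<close>
  have dcd: "c \<otimes> d = ?g \<oplus> d \<otimes> (c \<otimes> d)"
    using c d cd l_distr[of c d "c \<otimes> d"] by simp
  have "(c \<oplus> d) \<otimes> (c \<oplus> d) = c \<otimes> c \<oplus> (c \<otimes> d \<oplus> (c \<otimes> d \<oplus> d \<otimes> d))"
    using c d by (simp add: l_distr r_distr a_assoc m_comm)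
  moreover have "c' \<oplus> f = c \<otimes> c \<oplus> ((?g \<oplus> d \<otimes> (c \<otimes> d)) \<oplus> ((?g \<oplus> d \<otimes> (c \<otimes> d)) \<oplus> d \<otimes> d))"
    using c d by (simp add: c'_def f_def r_distr a_ac m_ac)
  ultimately have c'f: "c' \<oplus> f = \<one>" unfolding dcd[symmetric] cd by simp
  have "c' \<ominus> c' \<otimes> c' = c' \<otimes> f"
  proof -
    have "c' = c' \<otimes> c' \<oplus> c' \<otimes> f" using c' f c'f r_distr[of c' f c'] by simp
    moreover have "u \<oplus> v \<ominus> u = v" if "u \<in> carrier R" "v \<in> carrier R" for u v
      using that by algebra
    ultimately show ?thesis using c' f by (metis m_closed)
  qed
  also have "\<dots> = (x \<otimes> x) \<otimes> ((\<one> \<oplus> d \<oplus> d) \<otimes> (\<one> \<oplus> c \<oplus> c))"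
  proof -
    have "c \<otimes> c \<otimes> s \<otimes> (d \<otimes> d \<otimes> t) = ((c \<otimes> d) \<otimes> (c \<otimes> d)) \<otimes> (s \<otimes> t)"
      if "s \<in> carrier R" "t \<in> carrier R" for s t
      using c d that by (simp add: m_ac)
    then show ?thesis using c d by (simp add: c'_def f_def x)
  qed
  finally show "c' \<ominus> c' \<otimes> c' = (x \<otimes> x) \<otimes> ((\<one> \<oplus> d \<oplus> d) \<otimes> (\<one> \<oplus> c \<oplus> c))" .
qed

text \<open>Strong induction on the exponent: one lifting step about halves it, and each correction
  added on the way is a multiple of the original c - c^2. Keeping that factor explicit is what later
  makes c - e nilpotent.\<close>

lemma (in cring) idempotent_lift:
  assumes "c \<in> carrier R" "(c \<ominus> c \<otimes> c) [^] (n::nat) = \<zero>"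
  shows "\<exists>e\<in>carrier R. \<exists>g\<in>carrier R. e \<otimes> e = e \<and> c = e \<oplus> (c \<ominus> c \<otimes> c) \<otimes> g"
  using assms
proof (induction n arbitrary: c rule: less_induct)
  case (less n)
  note c = less.prems(1)
  define x where "x = c \<ominus> c \<otimes> c"
  have x: "x \<in> carrier R" using c by (simp add: x_def)
  show ?case
  \<comment> \<open>For n = 0 the hypothesis reads 1 = 0, for n = 1 it reads x = 0. Either way
    \<open>c\<close> is already idempotent and g = 0 serves.\<close>
  proof (cases "n \<le> 1")
    case True
    with less.prems x have "x = \<zero>"
      unfolding x_def [symmetric]
      by (metis le_antisym le_zero_eq less_one nat_pow_0 nat_pow_eone not_less one_zeroD singletonD)
    then have "c \<otimes> c = c" "c = c \<oplus> x \<otimes> \<zero>"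
      using c by (auto simp: x_def)
    then show ?thesis using c unfolding x_def by blast
  next
    case False
    define k where "k = (\<one> \<oplus> (\<one> \<ominus> c) \<oplus> (\<one> \<ominus> c)) \<otimes> (\<one> \<oplus> c \<oplus> c)"
    define c' where "c' = c \<otimes> c \<otimes> (\<one> \<oplus> (\<one> \<ominus> c) \<oplus> (\<one> \<ominus> c))"
    have car: "k \<in> carrier R" "c' \<in> carrier R" using c by (auto simp: k_def c'_def)
    have 1: "c = c' \<oplus> x \<otimes> (\<one> \<ominus> c \<ominus> c)" and 2: "c' \<ominus> c' \<otimes> c' = (x \<otimes> x) \<otimes> k"
      using idempotent_lift_step[OF c] by (simp_all add: x_def k_def c'_def)
    \<comment> \<open>Half of \<open>n\<close>, rounded up: 2m is at least n, so (x^2)^m vanishes,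
      while m < n requires n to be at least 2.\<close>
    define m where "m = (n + 1) div 2"
    have m: "m < n" "n \<le> m + m" using False by (auto simp: m_def)
    have "x [^] (m + m) = x [^] n \<otimes> x [^] (m + m - n)"
      using m x by (simp add: nat_pow_mult)
    also have "\<dots> = \<zero>" using less.prems(2) x unfolding x_def [symmetric] by simp
    finally have "(x \<otimes> x) [^] m = \<zero>" using x by (simp add: nat_pow_distrib nat_pow_mult)
    then have "(c' \<ominus> c' \<otimes> c') [^] m = \<zero>"
      using x car by (simp add: 2 nat_pow_distrib)
    from less.IH[OF m(1) car(2) this] obtain e g where
      eg: "e \<in> carrier R" "g \<in> carrier R" "e \<otimes> e = e" "c' = e \<oplus> (x \<otimes> x) \<otimes> k \<otimes> g"
      unfolding 2 by blast
    \<comment> \<open>Both the error of this step, x(1 - 2c), and the error x^2 k g from the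
      induction hypothesis contain the factor x.\<close>
    have "c = e \<oplus> x \<otimes> (x \<otimes> (k \<otimes> g) \<oplus> (\<one> \<ominus> c \<ominus> c))"
      by (subst 1, subst eg(4)) (use c x car eg in algebra)
    moreover have "x \<otimes> (k \<otimes> g) \<oplus> (\<one> \<ominus> c \<ominus> c) \<in> carrier R"
      using c x car eg by simp
    ultimately show ?thesis using eg unfolding x_def by blast
  qed
qed

context ring begin

text \<open>Replaces the search for a decomposition by a condition on one element. In the backward
  direction e and g are found in the bicommutant of \<open>a\<close>, so q = (a - a^2)g is a product
  of commuting factors, hence nilpotent, and e commutes with q.\<close>

lemma strongly_nil_clean_elem_iff:
  assumes a: "a \<in> carrier R"
  shows "strongly_nil_clean_elem R a \<longleftrightarrow> nilpotent_elem R (a \<ominus> a \<otimes> a)"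
proof
  assume "strongly_nil_clean_elem R a"
  then obtain e q and k :: nat where eq: "e \<in> carrier R" "e \<otimes> e = e" "q \<in> carrier R"
      "q [^] k = \<zero>" "a = e \<oplus> q" "e \<otimes> q = q \<otimes> e"
    by (auto simp: strongly_nil_clean_elem_def idempotent_elem_def nilpotent_elem_def)
  define g where "g = \<one> \<ominus> e \<ominus> e \<ominus> q"
  have g: "g \<in> carrier R" using eq by (simp add: g_def)
  have "a \<otimes> a = e \<oplus> (q \<otimes> e \<oplus> (q \<otimes> e \<oplus> q \<otimes> q))"
    using eq by (simp add: l_distr r_distr a_assoc)
  moreover have "q \<otimes> g = q \<ominus> (q \<otimes> e \<oplus> (q \<otimes> e \<oplus> q \<otimes> q))"
    using eq unfolding g_def by (simp add: minus_eq r_distr r_minus minus_add a_assoc)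
  moreover have "(e \<oplus> q) \<ominus> (e \<oplus> w) = q \<ominus> w" if "w \<in> carrier R" for w
    using eq(1,3) that by algebra
  ultimately have aq: "a \<ominus> a \<otimes> a = q \<otimes> g"
    using eq by simp
  have "q \<otimes> g = g \<otimes> q"
    using eq unfolding g_def by (simp add: minus_eq l_distr r_distr l_minus r_minus)
  then have "(a \<ominus> a \<otimes> a) [^] k = \<zero>"
    using eq g unfolding aq by (simp add: pow_mult_distrib)
  then show "nilpotent_elem R (a \<ominus> a \<otimes> a)"
    using a unfolding nilpotent_elem_def by auto
next
  assume "nilpotent_elem R (a \<ominus> a \<otimes> a)"
  then obtain n :: nat where n: "(a \<ominus> a \<otimes> a) [^] n = \<zero>"
    by (auto simp: nilpotent_elem_def)
  define H where "H = bicommutant a"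
  have H: "subcring H R" "H \<subseteq> carrier R" "a \<in> H"
    using a unfolding H_def by (auto simp: bicommutant_subcring bicommutant_self dest: bicommutant_carrier)
  interpret S: cring "R\<lparr>carrier := H\<rparr>"
    using H subcring_iff by blast
  \<comment> \<open>Additive inverses in the subring are formed with respect to the smaller carrier,
    so their agreement with those of \<open>R\<close> has to be established.\<close>
  have minus: "x \<ominus>\<^bsub>R\<lparr>carrier := H\<rparr>\<^esub> y = x \<ominus> y" if "x \<in> H" "y \<in> H" for x y
    using that add.m_inv_consistent[OF subring.axioms(1)[OF subcring.axioms(1)[OF H(1)]]]
    by (simp add: a_minus_def a_inv_def)
  have aa: "a \<otimes> a \<in> H" using S.m_closed H(3) by simp
  obtain e g where eg: "e \<in> H" "g \<in> H" "e \<otimes> e = e" "a = e \<oplus> (a \<ominus> a \<otimes> a) \<otimes> g"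
    using S.idempotent_lift[of a n] n H aa by (auto simp: minus nat_pow_consistent[symmetric])
  define q where "q = (a \<ominus> a \<otimes> a) \<otimes> g"
  have xH: "a \<ominus> a \<otimes> a \<in> H" using S.minus_closed H(3) aa by (simp add: minus)
  have q: "q \<in> H" unfolding q_def using S.m_closed xH eg by simp
  have "(a \<ominus> a \<otimes> a) \<otimes> g = g \<otimes> (a \<ominus> a \<otimes> a)"
    using S.m_comm xH eg by simp
  then have "q [^] n = \<zero>"
    unfolding q_def using n xH eg H(2) pow_mult_distrib[of "a \<ominus> a \<otimes> a" g n] by auto
  moreover have "e \<otimes> q = q \<otimes> e" using S.m_comm eg q by simp
  ultimately show "strongly_nil_clean_elem R a"
    unfolding strongly_nil_clean_elem_def idempotent_elem_def nilpotent_elem_def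
    using eg q H(2) by (intro exI[of _ e] exI[of _ q]) (auto simp: q_def)
qed

lemma nilpotent_elem_power:
  assumes "x \<in> carrier R" "nilpotent_elem R (x [^] (k::nat))"
  shows "nilpotent_elem R x"
  using assms by (auto simp: nilpotent_elem_def nat_pow_pow)

lemma ideal_power_ideal:
  assumes "ideal I R"
  shows "ideal (ideal_power R I k) R"
  by (induction k) (simp_all add: oneideal ideal_prod_is_ideal assms)

text \<open>Modulo \<open>T\<close> the recursion is multiplication by \<open>w\<close>. The
  sequence \<open>u\<close> will consist of the entries at one diagonal position in the powers of a
  matrix, with \<open>T\<close> the corresponding trace ideal.\<close>

lemma power_cong_ideal:
  assumes T: "ideal T R" and w: "w \<in> carrier R"
    and u: "\<And>i. u i \<in> carrier R" "u 0 = \<one>"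
    and step: "\<And>i::nat. \<exists>t\<in>T. u (Suc i) = u i \<otimes> w \<oplus> t"
  shows "u i \<ominus> w [^] i \<in> T"
proof (induction i)
  interpret T: ideal T R by (rule T)
  case 0
  then show ?case using u by (simp add: minus_eq r_neg)
next
  interpret T: ideal T R by (rule T)
  case (Suc i)
  obtain t where t: "t \<in> T" "u (Suc i) = u i \<otimes> w \<oplus> t" using step by blast
  have "u (Suc i) \<ominus> w [^] Suc i = (u i \<ominus> w [^] i) \<otimes> w \<oplus> t"
    using u(1)[of i] w t T.Icarr[OF t(1)] by (simp add: minus_eq l_distr l_minus a_ac)
  then show ?case using Suc t w by (simp add: T.I_r_closed T.a_closed)
qed

end

text \<open>Used with \<open>trace_subset\<close>: a condition on \<open>b\<close> that is the
  preimage of a subgroup under an additive map need only be tested on single products.\<close>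

lemma additive_subgroup_vimage:
  assumes "abelian_group G" "abelian_group H" "f \<in> hom (add_monoid G) (add_monoid H)"
    and "additive_subgroup S H"
  shows "additive_subgroup {x \<in> carrier G. f x \<in> S} G"
proof -
  interpret G: abelian_group G by fact
  interpret H: abelian_group H by fact
  interpret S: additive_subgroup S H by fact
  interpret f: group_hom "add_monoid G" "add_monoid H" f
    using assms(3) G.a_group H.a_group by (simp add: group_hom_def group_hom_axioms_def)
  have "f (\<ominus>\<^bsub>G\<^esub> x) = \<ominus>\<^bsub>H\<^esub> f x" if "x \<in> carrier G" for x
    using f.hom_inv[of x] that by (simp add: a_inv_def)
  then show ?thesis
    using f.hom_one f.hom_mult
    by (intro additive_subgroup.intro G.add.subgroupI) (auto simp: a_inv_def[symmetric] intro!: exI[of _ "\<zero>\<^bsub>G\<^esub>"])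
qed

lemma (in ring) zero_not_Unit:
  assumes "\<one> \<noteq> \<zero>"
  shows "\<zero> \<notin> Units R"
  using assms by (auto simp: Units_def)

section \<open>Calculation with cosets of formal sums of pairs, and scalar actions on pure
  tensors\<close>

section \<open>Tensor products and forms\<close>

locale tensor_pair = M: bimodule A B M + N: bimodule B C N
  for A :: "('a, 'x) ring_scheme" and B :: "('b, 'y) ring_scheme" and C :: "('c, 'z) ring_scheme"
    and M :: "('a, 'b, 'm) bimodule" and N :: "('b, 'c, 'n) bimodule"
begin

abbreviation "F \<equiv> tensor_free M N"
abbreviation "K \<equiv> tensor_kernel B M N"
abbreviation "pure \<equiv> pure_tensor B M N"
abbreviation "MN \<equiv> tensor_product B M N"

lemma F_simps [simp]:
  "f \<in> carrier F \<longleftrightarrow> Poly_Mapping.keys f \<subseteq> carrier M \<times> carrier N"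
  "f \<otimes>\<^bsub>F\<^esub> g = f + g" "\<one>\<^bsub>F\<^esub> = 0"
  by (simp_all add: tensor_free_def)

lemma comm_group_F: "comm_group F"
  by (simp add: tensor_free_def abelian_free_Abelian_group)

sublocale F: comm_group F
  by (rule comm_group_F)

lemma inv_F [simp]: "f \<in> carrier F \<Longrightarrow> inv\<^bsub>F\<^esub> f = - f"
  by (simp add: tensor_free_def)

lemma relators_in_carrier: "tensor_relators B M N \<subseteq> carrier F"
  unfolding tensor_relators_def
  by (auto dest!: keys_diff [THEN subsetD])

lemma subgroup_K: "subgroup K F"
  unfolding tensor_kernel_def by (rule F.generate_is_subgroup[OF relators_in_carrier])

lemma normal_K: "K \<lhd> F"
  using F.normal_iff_subgroup subgroup_K by blast

lemma rcoset_eq: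
  assumes "f \<in> carrier F" "g \<in> carrier F" "f - g \<in> K"
  shows "K #>\<^bsub>F\<^esub> f = K #>\<^bsub>F\<^esub> g"
proof (rule F.repr_independence[OF _ assms(2) subgroup_K, symmetric])
  show "f \<in> K #>\<^bsub>F\<^esub> g"
    unfolding r_coset_def using assms(3) by force
qed

lemma rcoset_sum:
  assumes "f \<in> carrier F" "g \<in> carrier F"
  shows "(K #>\<^bsub>F\<^esub> f) \<oplus>\<^bsub>MN\<^esub> (K #>\<^bsub>F\<^esub> g) = K #>\<^bsub>F\<^esub> (f + g)"
  using normal.rcos_sum[OF normal_K assms] by (simp add: tensor_product_def Let_def FactGroup_def)

lemma rcoset_in_carrier: "f \<in> carrier F \<Longrightarrow> K #>\<^bsub>F\<^esub> f \<in> carrier MN"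
  unfolding tensor_product_def FactGroup_def RCOSETS_def by (auto simp: Let_def)

lemma carrier_MN_E:
  assumes "T \<in> carrier MN"
  obtains f where "f \<in> carrier F" "T = K #>\<^bsub>F\<^esub> f"
  using assms unfolding tensor_product_def FactGroup_def RCOSETS_def by (auto simp: Let_def)

lemma frag_of_closed [simp]: "x \<in> carrier M \<Longrightarrow> y \<in> carrier N \<Longrightarrow> frag_of (x, y) \<in> carrier F"
  by simp

lemma pure_closed [simp]: "x \<in> carrier M \<Longrightarrow> y \<in> carrier N \<Longrightarrow> pure x y \<in> carrier MN"
  unfolding pure_tensor_def by (rule rcoset_in_carrier) simp

lemma pure_add_left:
  assumes "x \<in> carrier M" "x' \<in> carrier M" "y \<in> carrier N"
  shows "pure (x \<oplus>\<^bsub>M\<^esub> x') y = pure x y \<oplus>\<^bsub>MN\<^esub> pure x' y"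
proof -
  \<comment> \<open>Regrouped by \<open>diff_diff_eq\<close>, this difference is literally a relator
    of the first kind.\<close>
  have "frag_of (x \<oplus>\<^bsub>M\<^esub> x', y) - (frag_of (x, y) + frag_of (x', y)) \<in> K"
    unfolding tensor_kernel_def tensor_relators_def diff_diff_eq[symmetric]
    using assms by (intro generate.incl) blast
  moreover have "frag_of (x, y) + frag_of (x', y) \<in> carrier F"
    using assms F.m_closed[of "frag_of (x, y)" "frag_of (x', y)"] by simp
  ultimately show ?thesis
    unfolding pure_tensor_def using assms by (subst rcoset_sum) (simp_all add: rcoset_eq del: F_simps(1))
qed

lemma pure_add_right:
  assumes "x \<in> carrier M" "y \<in> carrier N" "y' \<in> carrier N"
  shows "pure x (y \<oplus>\<^bsub>N\<^esub> y') = pure x y \<oplus>\<^bsub>MN\<^esub> pure x y'"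
proof -
  have "frag_of (x, y \<oplus>\<^bsub>N\<^esub> y') - (frag_of (x, y) + frag_of (x, y')) \<in> K"
    unfolding tensor_kernel_def tensor_relators_def diff_diff_eq[symmetric]
    using assms by (intro generate.incl) blast
  moreover have "frag_of (x, y) + frag_of (x, y') \<in> carrier F"
    using assms F.m_closed[of "frag_of (x, y)" "frag_of (x, y')"] by simp
  ultimately show ?thesis
    unfolding pure_tensor_def using assms by (subst rcoset_sum) (simp_all add: rcoset_eq del: F_simps(1))
qed

lemma pure_balanced:
  assumes "x \<in> carrier M" "b \<in> carrier B" "y \<in> carrier N"
  shows "pure (x \<odot>r\<^bsub>M\<^esub> b) y = pure x (b \<odot>\<^bsub>N\<^esub> y)"
proof -
  have "frag_of (x \<odot>r\<^bsub>M\<^esub> b, y) - frag_of (x, b \<odot>\<^bsub>N\<^esub> y) \<in> K"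
    unfolding tensor_kernel_def tensor_relators_def
    using assms by (intro generate.incl) blast
  then show ?thesis
    unfolding pure_tensor_def using assms by (simp add: rcoset_eq)
qed

lemma frag_extend_closed:
  assumes h: "\<And>x y. x \<in> carrier M \<Longrightarrow> y \<in> carrier N \<Longrightarrow> h (x, y) \<in> carrier M \<times> carrier N"
    and "f \<in> carrier F"
  shows "frag_extend (\<lambda>p. frag_of (h p)) f \<in> carrier F"
proof -
  have "Poly_Mapping.keys (frag_extend (\<lambda>p. frag_of (h p)) f) \<subseteq> h ` Poly_Mapping.keys f"
    using keys_frag_extend[of "\<lambda>p. frag_of (h p)" f] by auto
  moreover have "h p \<in> carrier M \<times> carrier N" if "p \<in> Poly_Mapping.keys f" for p
  proof -
    have "p \<in> carrier M \<times> carrier N" using assms(2) that by auto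
    then show ?thesis using h[of "fst p" "snd p"] by (simp add: mem_Times_iff)
  qed
  ultimately show ?thesis unfolding F_simps(1) by blast
qed

text \<open>The extension of \<open>h\<close> is additive, so sending the generators of
  \<open>K\<close> into \<open>K\<close> suffices. This is the well-definedness of scalar actions on
  cosets.\<close>

lemma frag_extend_K:
  assumes h: "\<And>x y. x \<in> carrier M \<Longrightarrow> y \<in> carrier N \<Longrightarrow> h (x, y) \<in> carrier M \<times> carrier N"
    and rel: "\<And>r. r \<in> tensor_relators B M N \<Longrightarrow> frag_extend (\<lambda>p. frag_of (h p)) r \<in> K"
    and "k \<in> K"
  shows "frag_extend (\<lambda>p. frag_of (h p)) k \<in> K"
  using assms(3) unfolding tensor_kernel_def
proof induction
  case one
  then show ?case using generate.one[of F] by simp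
next
  case (incl r)
  then show ?case using rel unfolding tensor_kernel_def by blast
next
  case (inv r)
  then have r: "r \<in> carrier F" "frag_extend (\<lambda>p. frag_of (h p)) r \<in> K"
    using relators_in_carrier rel by blast+
  then show ?case
    using subgroup.m_inv_closed[OF subgroup_K r(2)] frag_extend_closed[of h r, OF h r(1)]
    unfolding inv_F[OF r(1)] tensor_kernel_def by (simp add: frag_extend_minus del: F_simps(1))
next
  case (eng f g)
  then show ?case using generate.eng[OF eng.IH] by (simp add: frag_extend_add)
qed

text \<open>Evaluates the union that defines a scalar action. Each representative is k + (x, y) with
  k in \<open>K\<close>; the image of k stays in \<open>K\<close>, so all members of the union are
  the same coset.\<close>

lemma rcoset_extend_pure:
  assumes h: "\<And>x y. x \<in> carrier M \<Longrightarrow> y \<in> carrier N \<Longrightarrow> h (x, y) \<in> carrier M \<times> carrier N"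
    and rel: "\<And>r. r \<in> tensor_relators B M N \<Longrightarrow> frag_extend (\<lambda>p. frag_of (h p)) r \<in> K"
    and xy: "x \<in> carrier M" "y \<in> carrier N"
  shows "(\<Union>t\<in>pure x y. K #>\<^bsub>F\<^esub> frag_extend (\<lambda>p. frag_of (h p)) t) = K #>\<^bsub>F\<^esub> frag_of (h (x, y))"
proof -
  have "K #>\<^bsub>F\<^esub> frag_extend (\<lambda>p. frag_of (h p)) t = K #>\<^bsub>F\<^esub> frag_of (h (x, y))"
    if "t \<in> pure x y" for t
  proof -
    from that obtain k where k: "k \<in> K" "t = k + frag_of (x, y)"
      unfolding pure_tensor_def r_coset_def by auto
    then have t: "t \<in> carrier F"
      using subgroup.mem_carrier[OF subgroup_K, of k] xy F.m_closed[of k "frag_of (x, y)"] by simp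
    show ?thesis
    proof (rule rcoset_eq)
      show "frag_extend (\<lambda>p. frag_of (h p)) t \<in> carrier F"
        using h t by (rule frag_extend_closed)
      show "frag_of (h (x, y)) \<in> carrier F" using h xy by simp
      show "frag_extend (\<lambda>p. frag_of (h p)) t - frag_of (h (x, y)) \<in> K"
        using frag_extend_K[of h k, OF h rel k(1)] by (simp add: k(2) frag_extend_add)
    qed
  qed
  moreover have "frag_of (x, y) \<in> pure x y"
    unfolding pure_tensor_def using xy by (intro F.rcos_self subgroup_K) simp
  ultimately show ?thesis by (intro SUP_eq_const) auto
qed

text \<open>Multiplying first components by \<open>a\<close> sends each relator to a relator of the
  same kind. For the balancing relators this is the compatibility of the left and right actions on
  \<open>M\<close>.\<close>

lemma lsmult_pure:
  assumes a: "a \<in> carrier A" and "x \<in> carrier M" "y \<in> carrier N"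
  shows "a \<odot>\<^bsub>MN\<^esub> pure x y = pure (a \<odot>\<^bsub>M\<^esub> x) y"
proof -
  let ?h = "\<lambda>(x, y). (a \<odot>\<^bsub>M\<^esub> x, y)"
  have eq: "(\<lambda>p. frag_of (?h p)) = (\<lambda>(x, y). frag_of (a \<odot>\<^bsub>M\<^esub> x, y))" by auto
  have "frag_extend (\<lambda>p. frag_of (?h p)) r \<in> K" if "r \<in> tensor_relators B M N" for r
  proof -
    from that have "frag_extend (\<lambda>p. frag_of (?h p)) r \<in> tensor_relators B M N"
      unfolding tensor_relators_def
    proof (elim UnE CollectE exE conjE, goal_cases)
      case (1 x x' y)
      then show ?case
        using a by (intro UnI1 CollectI exI[of _ "a \<odot>\<^bsub>M\<^esub> x"] exI[of _ "a \<odot>\<^bsub>M\<^esub> x'"] exI[of _ y])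
          (simp add: frag_extend_diff M.lsmult_r_distr)
    next
      case (2 x y y')
      then show ?case
        using a by (intro UnI1[OF UnI2] CollectI exI[of _ "a \<odot>\<^bsub>M\<^esub> x"] exI[of _ y] exI[of _ y'])
          (simp add: frag_extend_diff)
    next
      case (3 x b y)
      then show ?case
        using a by (intro UnI2 CollectI exI[of _ "a \<odot>\<^bsub>M\<^esub> x"] exI[of _ b] exI[of _ y])
          (simp add: frag_extend_diff M.smult_compat)
    qed
    then show ?thesis unfolding tensor_kernel_def by (rule generate.incl)
  qed
  then show ?thesis
    using rcoset_extend_pure[of ?h x y] assms
    by (simp add: eq tensor_product_def Let_def) (simp add: pure_tensor_def)
qed

lemma rsmult_pure:
  assumes c: "c \<in> carrier C" and "x \<in> carrier M" "y \<in> carrier N"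
  shows "pure x y \<odot>r\<^bsub>MN\<^esub> c = pure x (y \<odot>r\<^bsub>N\<^esub> c)"
proof -
  let ?h = "\<lambda>(x, y). (x, y \<odot>r\<^bsub>N\<^esub> c)"
  have eq: "(\<lambda>p. frag_of (?h p)) = (\<lambda>(x, y). frag_of (x, y \<odot>r\<^bsub>N\<^esub> c))" by auto
  have "frag_extend (\<lambda>p. frag_of (?h p)) r \<in> K" if "r \<in> tensor_relators B M N" for r
  proof -
    from that have "frag_extend (\<lambda>p. frag_of (?h p)) r \<in> tensor_relators B M N"
      unfolding tensor_relators_def
    proof (elim UnE CollectE exE conjE, goal_cases)
      case (1 x x' y)
      then show ?case
        using c by (intro UnI1 CollectI exI[of _ x] exI[of _ x'] exI[of _ "y \<odot>r\<^bsub>N\<^esub> c"])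
          (simp add: frag_extend_diff)
    next
      case (2 x y y')
      then show ?case
        using c by (intro UnI1[OF UnI2] CollectI exI[of _ x] exI[of _ "y \<odot>r\<^bsub>N\<^esub> c"] exI[of _ "y' \<odot>r\<^bsub>N\<^esub> c"])
          (simp add: frag_extend_diff N.rsmult_l_distr)
    next
      case (3 x b y)
      then show ?case
        using c by (intro UnI2 CollectI exI[of _ x] exI[of _ b] exI[of _ "y \<odot>r\<^bsub>N\<^esub> c"])
          (simp add: frag_extend_diff N.smult_compat)
    qed
    then show ?thesis unfolding tensor_kernel_def by (rule generate.incl)
  qed
  then show ?thesis
    using rcoset_extend_pure[of ?h x y] assms
    by (simp add: eq tensor_product_def Let_def) (simp add: pure_tensor_def)
qed

end

section \<open>The balanced biadditive pairing given by a bimodule homomorphism, and its trace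
  ideal\<close>

locale tensor_form = tensor_pair A B A M N
  for A :: "('a, 'x) ring_scheme" and B :: "('b, 'y) ring_scheme"
    and M :: "('a, 'b, 'm) bimodule" and N :: "('b, 'a, 'n) bimodule" +
  fixes \<phi> :: "('m \<times> 'n \<Rightarrow>\<^sub>0 int) set \<Rightarrow> 'a"
  assumes hom: "\<phi> \<in> bimodule_hom A A (tensor_product B M N) (regular_bimodule A)"
begin

abbreviation form :: "'m \<Rightarrow> 'n \<Rightarrow> 'a" (infixl \<open>\<bullet>\<close> 70) where
  "x \<bullet> y \<equiv> \<phi> (pure_tensor B M N x y)"

lemma hom_closed [simp]: "T \<in> carrier MN \<Longrightarrow> \<phi> T \<in> carrier A"
  using hom by (auto simp: bimodule_hom_def hom_def regular_bimodule_def)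

lemma hom_add: "T \<in> carrier MN \<Longrightarrow> T' \<in> carrier MN \<Longrightarrow> \<phi> (T \<oplus>\<^bsub>MN\<^esub> T') = \<phi> T \<oplus>\<^bsub>A\<^esub> \<phi> T'"
  using hom by (auto simp: bimodule_hom_def hom_def regular_bimodule_def)

lemma form_add_left:
  "\<lbrakk>x \<in> carrier M; x' \<in> carrier M; y \<in> carrier N\<rbrakk> \<Longrightarrow> (x \<oplus>\<^bsub>M\<^esub> x') \<bullet> y = x \<bullet> y \<oplus>\<^bsub>A\<^esub> x' \<bullet> y"
  by (simp add: pure_add_left hom_add)

lemma form_add_right:
  "\<lbrakk>x \<in> carrier M; y \<in> carrier N; y' \<in> carrier N\<rbrakk> \<Longrightarrow> x \<bullet> (y \<oplus>\<^bsub>N\<^esub> y') = x \<bullet> y \<oplus>\<^bsub>A\<^esub> x \<bullet> y'"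
  by (simp add: pure_add_right hom_add)

lemma form_balanced:
  "\<lbrakk>x \<in> carrier M; b \<in> carrier B; y \<in> carrier N\<rbrakk> \<Longrightarrow> (x \<odot>r\<^bsub>M\<^esub> b) \<bullet> y = x \<bullet> (b \<odot>\<^bsub>N\<^esub> y)"
  by (simp add: pure_balanced)

lemma form_lsmult:
  assumes "a \<in> carrier A" "x \<in> carrier M" "y \<in> carrier N"
  shows "(a \<odot>\<^bsub>M\<^esub> x) \<bullet> y = a \<otimes>\<^bsub>A\<^esub> (x \<bullet> y)"
proof -
  have "\<phi> (a \<odot>\<^bsub>MN\<^esub> pure x y) = a \<otimes>\<^bsub>A\<^esub> (x \<bullet> y)"
    using hom assms by (simp add: bimodule_hom_def regular_bimodule_def)
  then show ?thesis using assms by (simp add: lsmult_pure)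
qed

lemma form_rsmult:
  assumes "x \<in> carrier M" "y \<in> carrier N" "a \<in> carrier A"
  shows "x \<bullet> (y \<odot>r\<^bsub>N\<^esub> a) = (x \<bullet> y) \<otimes>\<^bsub>A\<^esub> a"
proof -
  have "\<phi> (pure x y \<odot>r\<^bsub>MN\<^esub> a) = (x \<bullet> y) \<otimes>\<^bsub>A\<^esub> a"
    using hom assms by (simp add: bimodule_hom_def regular_bimodule_def)
  then show ?thesis using assms by (simp add: rsmult_pure)
qed

lemma form_zero_left: "y \<in> carrier N \<Longrightarrow> \<zero>\<^bsub>M\<^esub> \<bullet> y = \<zero>\<^bsub>A\<^esub>"
  using form_add_left[of "\<zero>\<^bsub>M\<^esub>" "\<zero>\<^bsub>M\<^esub>" y] by simp

lemma form_zero_right: "x \<in> carrier M \<Longrightarrow> x \<bullet> \<zero>\<^bsub>N\<^esub> = \<zero>\<^bsub>A\<^esub>"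
  using form_add_right[of x "\<zero>\<^bsub>N\<^esub>" "\<zero>\<^bsub>N\<^esub>"] by simp

lemma form_in_trace: "x \<in> carrier M \<Longrightarrow> y \<in> carrier N \<Longrightarrow> x \<bullet> y \<in> trace_ideal B M N \<phi>"
  by (simp add: trace_ideal_def)

text \<open>A tensor is the coset of an integer combination of pairs, and \<open>\<phi>\<close> is
  additive on such cosets. Statements about single products mn thus extend to the whole trace
  ideal.\<close>

lemma trace_subset:
  assumes H: "additive_subgroup H A"
    and forms: "\<And>x y. x \<in> carrier M \<Longrightarrow> y \<in> carrier N \<Longrightarrow> x \<bullet> y \<in> H"
  shows "trace_ideal B M N \<phi> \<subseteq> H"
proof -
  interpret H: additive_subgroup H A by (rule H)
  let ?\<Phi> = "\<lambda>f. \<phi> (K #>\<^bsub>F\<^esub> f)"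
  have add: "?\<Phi> (f + g) = ?\<Phi> f \<oplus>\<^bsub>A\<^esub> ?\<Phi> g" "?\<Phi> f \<in> carrier A"
    if "f \<in> carrier F" "g \<in> carrier F" for f g
    using that hom_add[of "K #>\<^bsub>F\<^esub> f" "K #>\<^bsub>F\<^esub> g"]
    by (auto simp: rcoset_in_carrier rcoset_sum simp del: F_simps(1))
  have "f \<in> carrier F \<and> ?\<Phi> f \<in> H" if "Poly_Mapping.keys f \<subseteq> carrier M \<times> carrier N" for f
    using that
  proof (induction rule: frag_induction)
    case zero
    have "?\<Phi> 0 = \<zero>\<^bsub>A\<^esub>" using add[of 0 0] by simp
    then show ?case by simp
  next
    case (one p)
    then show ?case using forms by (auto simp: pure_tensor_def)
  next
    case (diff f g)
    then have d: "f - g \<in> carrier F"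
      using keys_diff[of f g] by auto
    \<comment> \<open>The induction runs over differences while \<open>\<phi>\<close> is known only
      to preserve sums, so the difference is recovered from f = (f - g) + g.\<close>
    have "?\<Phi> f = ?\<Phi> (f - g) \<oplus>\<^bsub>A\<^esub> ?\<Phi> g"
      using add(1)[of "f - g" g] diff d by simp
    then have "?\<Phi> (f - g) = ?\<Phi> f \<ominus>\<^bsub>A\<^esub> ?\<Phi> g"
      using add(2)[of "f - g" g] add(2)[of g g] diff d by (simp add: M.A.minus_eq M.A.a_assoc M.A.r_neg)
    then show ?case
      using diff d H.a_closed[of "?\<Phi> f" "\<ominus>\<^bsub>A\<^esub> ?\<Phi> g"] H.a_inv_closed by (simp add: M.A.minus_eq)
  qed
  then show ?thesis
    unfolding trace_ideal_def by (auto elim!: carrier_MN_E)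
qed

end

section \<open>The ring of matrices, and nilpotency of matrices with diagonal in the trace
  ideals\<close>

section \<open>The Morita context ring\<close>

sublocale morita_context \<subseteq> MN: tensor_form A B M N \<phi>
  by unfold_locales (rule \<phi>_hom)

sublocale morita_context \<subseteq> NM: tensor_form B A N M \<psi>
  by unfold_locales (rule \<psi>_hom)

text \<open>The two associativity conditions exchange roles. Results on first rows of matrices
  thereby apply to second rows.\<close>

lemma (in morita_context) morita_context_swap: "morita_context B A N M \<psi> \<phi>"
  by unfold_locales (simp_all add: \<phi>_hom \<psi>_hom M_assoc N_assoc)

lemma (in bimodule) smult_zeros [simp]:
  "x \<in> carrier M \<Longrightarrow> \<zero>\<^bsub>A\<^esub> \<odot>\<^bsub>M\<^esub> x = \<zero>\<^bsub>M\<^esub>" "a \<in> carrier A \<Longrightarrow> a \<odot>\<^bsub>M\<^esub> \<zero>\<^bsub>M\<^esub> = \<zero>\<^bsub>M\<^esub>"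
  "x \<in> carrier M \<Longrightarrow> x \<odot>r\<^bsub>M\<^esub> \<zero>\<^bsub>B\<^esub> = \<zero>\<^bsub>M\<^esub>" "b \<in> carrier B \<Longrightarrow> \<zero>\<^bsub>M\<^esub> \<odot>r\<^bsub>M\<^esub> b = \<zero>\<^bsub>M\<^esub>"
  using lsmult_l_distr[of "\<zero>\<^bsub>A\<^esub>" "\<zero>\<^bsub>A\<^esub>" x] lsmult_r_distr[of a "\<zero>\<^bsub>M\<^esub>" "\<zero>\<^bsub>M\<^esub>"]
    rsmult_r_distr[of x "\<zero>\<^bsub>B\<^esub>" "\<zero>\<^bsub>B\<^esub>"] rsmult_l_distr[of "\<zero>\<^bsub>M\<^esub>" "\<zero>\<^bsub>M\<^esub>" b] by simp_all

context morita_context begin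

abbreviation "R \<equiv> morita_ring A B M N \<phi> \<psi>"

lemma morita_ring_simps:
  "(a, m, n, b) \<in> carrier R \<longleftrightarrow> a \<in> carrier A \<and> m \<in> carrier M \<and> n \<in> carrier N \<and> b \<in> carrier B"
  "(a, m, n, b) \<otimes>\<^bsub>R\<^esub> (a', m', n', b') =
     (a \<otimes>\<^bsub>A\<^esub> a' \<oplus>\<^bsub>A\<^esub> \<phi> (pure_tensor B M N m n'), a \<odot>\<^bsub>M\<^esub> m' \<oplus>\<^bsub>M\<^esub> m \<odot>r\<^bsub>M\<^esub> b',
      n \<odot>r\<^bsub>N\<^esub> a' \<oplus>\<^bsub>N\<^esub> b \<odot>\<^bsub>N\<^esub> n', \<psi> (pure_tensor A N M n m') \<oplus>\<^bsub>B\<^esub> b \<otimes>\<^bsub>B\<^esub> b')"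
  "(a, m, n, b) \<oplus>\<^bsub>R\<^esub> (a', m', n', b') = (a \<oplus>\<^bsub>A\<^esub> a', m \<oplus>\<^bsub>M\<^esub> m', n \<oplus>\<^bsub>N\<^esub> n', b \<oplus>\<^bsub>B\<^esub> b')"
  "\<zero>\<^bsub>R\<^esub> = (\<zero>\<^bsub>A\<^esub>, \<zero>\<^bsub>M\<^esub>, \<zero>\<^bsub>N\<^esub>, \<zero>\<^bsub>B\<^esub>)" "\<one>\<^bsub>R\<^esub> = (\<one>\<^bsub>A\<^esub>, \<zero>\<^bsub>M\<^esub>, \<zero>\<^bsub>N\<^esub>, \<one>\<^bsub>B\<^esub>)"
  by (auto simp: morita_ring_def)

lemma morita_carrier_E:
  assumes "x \<in> carrier R"
  obtains a m n b where "x = (a, m, n, b)" "a \<in> carrier A" "m \<in> carrier M" "n \<in> carrier N" "b \<in> carrier B"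
  using assms by (auto simp: morita_ring_def)

text \<open>For associativity, the diagonal entries use that the forms are balanced and linear over
  the outer ring, while the off-diagonal entries use the mixed laws (mn)m' = m(nm') and (nm)n' =
  n(mn').\<close>

lemma ring_morita_ring: "ring R"
proof (intro ringI abelian_groupI monoidI)
  fix x y z assume "x \<in> carrier R" "y \<in> carrier R" "z \<in> carrier R"
  then obtain a m n b a' m' n' b' a'' m'' n'' b'' where xyz:
    "x = (a, m, n, b)" "y = (a', m', n', b')" "z = (a'', m'', n'', b'')"
    and car: "a \<in> carrier A" "m \<in> carrier M" "n \<in> carrier N" "b \<in> carrier B"
      "a' \<in> carrier A" "m' \<in> carrier M" "n' \<in> carrier N" "b' \<in> carrier B"
      "a'' \<in> carrier A" "m'' \<in> carrier M" "n'' \<in> carrier N" "b'' \<in> carrier B"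
    by (elim morita_carrier_E) blast
  show "x \<oplus>\<^bsub>R\<^esub> y \<oplus>\<^bsub>R\<^esub> z = x \<oplus>\<^bsub>R\<^esub> (y \<oplus>\<^bsub>R\<^esub> z)"
    using car by (simp add: xyz morita_ring_simps M.A.a_assoc M.B.a_assoc M.M.a_assoc N.M.a_assoc)
  show "x \<oplus>\<^bsub>R\<^esub> y = y \<oplus>\<^bsub>R\<^esub> x"
    using car by (simp add: xyz morita_ring_simps M.A.a_comm M.B.a_comm M.M.a_comm N.M.a_comm)
  show "(x \<oplus>\<^bsub>R\<^esub> y) \<otimes>\<^bsub>R\<^esub> z = x \<otimes>\<^bsub>R\<^esub> z \<oplus>\<^bsub>R\<^esub> y \<otimes>\<^bsub>R\<^esub> z"
    using car by (simp add: xyz morita_ring_simps M.A.l_distr M.B.l_distr MN.form_add_left NM.form_add_left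
        M.lsmult_l_distr N.lsmult_l_distr M.rsmult_l_distr N.rsmult_l_distr M.A.a_ac M.B.a_ac M.M.a_ac N.M.a_ac)
  show "z \<otimes>\<^bsub>R\<^esub> (x \<oplus>\<^bsub>R\<^esub> y) = z \<otimes>\<^bsub>R\<^esub> x \<oplus>\<^bsub>R\<^esub> z \<otimes>\<^bsub>R\<^esub> y"
    using car by (simp add: xyz morita_ring_simps M.A.r_distr M.B.r_distr MN.form_add_right NM.form_add_right
        M.lsmult_r_distr N.lsmult_r_distr M.rsmult_r_distr N.rsmult_r_distr M.A.a_ac M.B.a_ac M.M.a_ac N.M.a_ac)
  show "(x \<otimes>\<^bsub>R\<^esub> y) \<otimes>\<^bsub>R\<^esub> z = x \<otimes>\<^bsub>R\<^esub> (y \<otimes>\<^bsub>R\<^esub> z)"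
    using car by (simp add: xyz morita_ring_simps M.A.l_distr M.B.l_distr M.A.r_distr M.B.r_distr
        MN.form_add_left NM.form_add_left MN.form_add_right NM.form_add_right
        M.lsmult_l_distr N.lsmult_l_distr M.rsmult_l_distr N.rsmult_l_distr
        M.lsmult_r_distr N.lsmult_r_distr M.rsmult_r_distr N.rsmult_r_distr
        MN.form_balanced NM.form_balanced MN.form_lsmult NM.form_lsmult MN.form_rsmult NM.form_rsmult
        M_assoc N_assoc M.lsmult_assoc N.lsmult_assoc M.rsmult_assoc N.rsmult_assoc
        M.smult_compat N.smult_compat M.A.m_assoc M.B.m_assoc
        M.A.a_ac M.B.a_ac M.M.a_ac N.M.a_ac)
next
  fix x assume "x \<in> carrier R"
  then obtain a m n b where x: "x = (a, m, n, b)" "a \<in> carrier A" "m \<in> carrier M" "n \<in> carrier N" "b \<in> carrier B"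
    by (elim morita_carrier_E) blast
  show "\<zero>\<^bsub>R\<^esub> \<oplus>\<^bsub>R\<^esub> x = x" using x by (simp add: morita_ring_simps)
  have "(\<ominus>\<^bsub>A\<^esub> a, \<ominus>\<^bsub>M\<^esub> m, \<ominus>\<^bsub>N\<^esub> n, \<ominus>\<^bsub>B\<^esub> b) \<in> carrier R"
    "(\<ominus>\<^bsub>A\<^esub> a, \<ominus>\<^bsub>M\<^esub> m, \<ominus>\<^bsub>N\<^esub> n, \<ominus>\<^bsub>B\<^esub> b) \<oplus>\<^bsub>R\<^esub> x = \<zero>\<^bsub>R\<^esub>"
    using x by (simp_all add: morita_ring_simps M.A.l_neg M.B.l_neg M.M.l_neg N.M.l_neg)
  then show "\<exists>y\<in>carrier R. y \<oplus>\<^bsub>R\<^esub> x = \<zero>\<^bsub>R\<^esub>" by blast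
  show "\<one>\<^bsub>R\<^esub> \<otimes>\<^bsub>R\<^esub> x = x" "x \<otimes>\<^bsub>R\<^esub> \<one>\<^bsub>R\<^esub> = x"
    using x by (simp_all add: morita_ring_simps MN.form_zero_left MN.form_zero_right NM.form_zero_left NM.form_zero_right)
qed (auto simp: morita_ring_def)

text \<open>For b = nm one has (v(nm))y = ((vn)m)y = (vn)(my), with \<open>vn\<close> in the j-th
  power and \<open>my\<close> in the trace ideal. The left side is additive in \<open>b\<close>,
  which covers all of NM.\<close>

lemma smult_trace_form:
  assumes I: "ideal (trace_ideal B M N \<phi>) A" and v: "v \<in> carrier M"
    and vN: "\<And>y. y \<in> carrier N \<Longrightarrow> \<phi> (pure_tensor B M N v y) \<in> ideal_power A (trace_ideal B M N \<phi>) j"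
    and b: "b \<in> trace_ideal A N M \<psi>" and y: "y \<in> carrier N"
  shows "\<phi> (pure_tensor B M N (v \<odot>r\<^bsub>M\<^esub> b) y) \<in> ideal_power A (trace_ideal B M N \<phi>) (Suc j)"
proof -
  let ?S = "ideal_power A (trace_ideal B M N \<phi>) (Suc j)"
  let ?f = "\<lambda>b. \<phi> (pure_tensor B M N (v \<odot>r\<^bsub>M\<^esub> b) y)"
  have "ideal ?S A" by (rule M.A.ideal_power_ideal[OF I])
  then have S: "additive_subgroup ?S A" by (rule ideal.axioms)
  have "?f \<in> hom (add_monoid B) (add_monoid A)"
    using v y by (auto simp: hom_def M.rsmult_r_distr MN.form_add_left)
  then have "additive_subgroup {b \<in> carrier B. ?f b \<in> ?S} B"
    by (rule additive_subgroup_vimage[OF M.B.abelian_group_axioms M.A.abelian_group_axioms _ S])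
  moreover have "?f (\<psi> (pure_tensor A N M n m)) \<in> ?S" if "n \<in> carrier N" "m \<in> carrier M" for n m
    using that v y vN[of n] MN.form_in_trace[of m y]
    by (auto simp: M_assoc[symmetric] MN.form_lsmult intro: ideal_prod.prod)
  ultimately show ?thesis
    using NM.trace_subset[of "{b \<in> carrier B. ?f b \<in> ?S}"] b by auto
qed

text \<open>For b = nm this is v(nm) = (vn)m = 0, extended additively. Vanishing of all products vn
  need not make \<open>v\<close> zero, but it does make \<open>v\<close> vanish after multiplication
  by NM.\<close>

lemma smult_trace_zero:
  assumes v: "v \<in> carrier M"
    and vN: "\<And>y. y \<in> carrier N \<Longrightarrow> \<phi> (pure_tensor B M N v y) = \<zero>\<^bsub>A\<^esub>"
    and b: "b \<in> trace_ideal A N M \<psi>"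
  shows "v \<odot>r\<^bsub>M\<^esub> b = \<zero>\<^bsub>M\<^esub>"
proof -
  have S: "additive_subgroup {\<zero>\<^bsub>M\<^esub>} M"
    by (intro additive_subgroup.intro M.M.add.subgroupI) (auto simp: a_inv_def[symmetric])
  have "(\<lambda>b. v \<odot>r\<^bsub>M\<^esub> b) \<in> hom (add_monoid B) (add_monoid M)"
    using v by (auto simp: hom_def M.rsmult_r_distr)
  then have "additive_subgroup {b \<in> carrier B. v \<odot>r\<^bsub>M\<^esub> b \<in> {\<zero>\<^bsub>M\<^esub>}} B"
    by (rule additive_subgroup_vimage[OF M.B.abelian_group_axioms M.M.abelian_group_axioms _ S])
  moreover have "v \<odot>r\<^bsub>M\<^esub> \<psi> (pure_tensor A N M n m) = \<zero>\<^bsub>M\<^esub>"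
    if "n \<in> carrier N" "m \<in> carrier M" for n m
    using that v vN[of n] by (simp add: M_assoc[symmetric])
  ultimately show ?thesis
    using NM.trace_subset[of "{b \<in> carrier B. v \<odot>r\<^bsub>M\<^esub> b \<in> {\<zero>\<^bsub>M\<^esub>}}"] b by auto
qed

text \<open>The pair (u i, v i) is a row that is repeatedly multiplied on the right by the matrix
  (a, m; n, b). As \<open>M\<close> has no filtration of its own, \<open>v i\<close> is measured by
  its products with \<open>N\<close>. Every two steps move both entries from the j-th to the next
  power of MN.\<close>

lemma row_eventually_zero:
  assumes nil: "nilpotent_ideal (trace_ideal B M N \<phi>) A"
    and x: "a \<in> trace_ideal B M N \<phi>" "m \<in> carrier M" "n \<in> carrier N" "b \<in> trace_ideal A N M \<psi>"
    and uv: "\<And>i::nat. u i \<in> carrier A" "\<And>i. v i \<in> carrier M"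
    and u_Suc: "\<And>i. u (Suc i) = u i \<otimes>\<^bsub>A\<^esub> a \<oplus>\<^bsub>A\<^esub> \<phi> (pure_tensor B M N (v i) n)"
    and v_Suc: "\<And>i. v (Suc i) = u i \<odot>\<^bsub>M\<^esub> m \<oplus>\<^bsub>M\<^esub> v i \<odot>r\<^bsub>M\<^esub> b"
  shows "\<exists>k. \<forall>i\<ge>k. u i = \<zero>\<^bsub>A\<^esub> \<and> v i = \<zero>\<^bsub>M\<^esub>"
proof -
  let ?T = "trace_ideal B M N \<phi>" and ?I = "ideal_power A (trace_ideal B M N \<phi>)"
  obtain k where T: "ideal ?T A" and k: "?I k = {\<zero>\<^bsub>A\<^esub>}"
    using nil by (auto simp: nilpotent_ideal_def)
  interpret I: ideal "?I j" A for j by (rule M.A.ideal_power_ideal[OF T])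
  have car: "a \<in> carrier A" "b \<in> carrier B"
    using x unfolding trace_ideal_def by auto
  have T_prod: "c \<otimes>\<^bsub>A\<^esub> t \<in> ?I (Suc j)" if "c \<in> ?I j" "t \<in> ?T" for c t j
    using that by (auto intro: ideal_prod.prod)
  have v_Suc_form: "\<phi> (pure_tensor B M N (v (Suc i)) y) \<in> ?I (Suc j)"
    if "u i \<in> ?I j" "\<forall>y\<in>carrier N. \<phi> (pure_tensor B M N (v i) y) \<in> ?I j" "y \<in> carrier N" for i j y
  proof -
    have "\<phi> (pure_tensor B M N (v (Suc i)) y) =
        u i \<otimes>\<^bsub>A\<^esub> \<phi> (pure_tensor B M N m y) \<oplus>\<^bsub>A\<^esub> \<phi> (pure_tensor B M N (v i \<odot>r\<^bsub>M\<^esub> b) y)"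
      using that uv x car by (simp add: v_Suc MN.form_add_left MN.form_lsmult)
    moreover have "u i \<otimes>\<^bsub>A\<^esub> \<phi> (pure_tensor B M N m y) \<in> ?I (Suc j)"
      using that x by (intro T_prod MN.form_in_trace)
    moreover have "\<phi> (pure_tensor B M N (v i \<odot>r\<^bsub>M\<^esub> b) y) \<in> ?I (Suc j)"
      using that uv x(4) by (intro smult_trace_form[OF T]) auto
    ultimately show ?thesis using I.a_closed by metis
  qed
  have inv: "u (2 * j) \<in> ?I j \<and> (\<forall>y\<in>carrier N. \<phi> (pure_tensor B M N (v (2 * j)) y) \<in> ?I j)" for j
  proof (induction j)
    case 0
    then show ?case using uv by simp
  next
    case (Suc j)
    let ?i = "Suc (2 * j)"
    \<comment> \<open>The first step improves only \<open>v\<close>: the summand \<open>v n\<close>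
      of the new \<open>u\<close> is so far known to lie just in the j-th power.\<close>
    have 1: "u ?i \<in> ?I j"
      unfolding u_Suc using Suc x car by (intro I.a_closed I.I_r_closed) auto
    have 2: "\<forall>y\<in>carrier N. \<phi> (pure_tensor B M N (v ?i) y) \<in> ?I (Suc j)"
      using Suc v_Suc_form[of "2 * j" j] by blast
    have sub: "?I (Suc j) \<subseteq> ?I j"
      using M.A.ideal_prod_inter[OF M.A.ideal_power_ideal[OF T] T] by auto
    \<comment> \<open>Now the products of \<open>v\<close> with \<open>N\<close> have already
      advanced, so \<open>u\<close> advances as well.\<close>
    have "u (Suc ?i) \<in> ?I (Suc j)"
      unfolding u_Suc[of ?i] using 2 x by (intro I.a_closed T_prod 1) auto
    moreover have "\<forall>y\<in>carrier N. \<phi> (pure_tensor B M N (v (Suc ?i)) y) \<in> ?I (Suc j)"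
      using 1 2 sub v_Suc_form[of ?i j] by blast
    ultimately show ?case by (simp del: ideal_power.simps)
  qed
  \<comment> \<open>At index 2k, \<open>u\<close> and all products of \<open>v\<close> with
    \<open>N\<close> vanish, but \<open>v\<close> may not; one further step kills it through
    \<open>smult_trace_zero\<close>. From then on the row stays zero.\<close>
  have "u (Suc (2 * k) + i) = \<zero>\<^bsub>A\<^esub> \<and> v (Suc (2 * k) + i) = \<zero>\<^bsub>M\<^esub>" for i
  proof (induction i)
    case 0
    have "u (2 * k) = \<zero>\<^bsub>A\<^esub>" "\<And>y. y \<in> carrier N \<Longrightarrow> \<phi> (pure_tensor B M N (v (2 * k)) y) = \<zero>\<^bsub>A\<^esub>"
      using inv[of k] k by auto
    then show ?case
      using x car uv smult_trace_zero[of "v (2 * k)" b] by (simp add: u_Suc v_Suc)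
  next
    case (Suc i)
    then show ?case
      using x car u_Suc[of "Suc (2 * k) + i"] v_Suc[of "Suc (2 * k) + i"] by (simp add: MN.form_zero_left)
  qed
  then show ?thesis by (intro exI[of _ "Suc (2 * k)"]) (metis le_iff_add)
qed

text \<open>The rows of the powers of the matrix evolve independently of each other under right
  multiplication. The first is handled by \<open>row_eventually_zero\<close>, the second by the same
  lemma in the swapped context.\<close>

lemma nilpotent_elem_off_diagonal:
  assumes nil: "nilpotent_ideal (trace_ideal B M N \<phi>) A" "nilpotent_ideal (trace_ideal A N M \<psi>) B"
    and x: "a \<in> trace_ideal B M N \<phi>" "m \<in> carrier M" "n \<in> carrier N" "b \<in> trace_ideal A N M \<psi>"
  shows "nilpotent_elem R (a, m, n, b)"
proof -
  interpret R: ring R by (rule ring_morita_ring)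
  interpret swap: morita_context B A N M \<psi> \<phi> by (rule morita_context_swap)
  let ?x = "(a, m, n, b)"
  have car: "a \<in> carrier A" "b \<in> carrier B"
    using x unfolding trace_ideal_def by auto
  have xR: "?x \<in> carrier R" using x car by (simp add: morita_ring_simps)
  define p where "p i = ?x [^]\<^bsub>R\<^esub> i" for i :: nat
  define u where "u i = fst (p i)" for i
  define v where "v i = fst (snd (p i))" for i
  define w where "w i = fst (snd (snd (p i)))" for i
  define z where "z i = snd (snd (snd (p i)))" for i
  have p: "p i = (u i, v i, w i, z i)" for i by (simp add: u_def v_def w_def z_def)
  have "p i \<in> carrier R" for i using xR by (simp add: p_def)
  then have pc: "u i \<in> carrier A" "v i \<in> carrier M" "w i \<in> carrier N" "z i \<in> carrier B" for i
    by (simp_all add: p morita_ring_simps)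
  have "p (Suc i) = p i \<otimes>\<^bsub>R\<^esub> ?x" for i by (simp add: p_def)
  then have rec: "u (Suc i) = u i \<otimes>\<^bsub>A\<^esub> a \<oplus>\<^bsub>A\<^esub> \<phi> (pure_tensor B M N (v i) n)"
    "v (Suc i) = u i \<odot>\<^bsub>M\<^esub> m \<oplus>\<^bsub>M\<^esub> v i \<odot>r\<^bsub>M\<^esub> b"
    "w (Suc i) = w i \<odot>r\<^bsub>N\<^esub> a \<oplus>\<^bsub>N\<^esub> z i \<odot>\<^bsub>N\<^esub> n"
    "z (Suc i) = \<psi> (pure_tensor A N M (w i) m) \<oplus>\<^bsub>B\<^esub> z i \<otimes>\<^bsub>B\<^esub> b" for i
    by (simp_all add: p morita_ring_simps)
  obtain k where k: "\<forall>i\<ge>k. u i = \<zero>\<^bsub>A\<^esub> \<and> v i = \<zero>\<^bsub>M\<^esub>"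
    using row_eventually_zero[where u = u and v = v, OF nil(1) x pc(1,2) rec(1,2)] by blast
  \<comment> \<open>The summands are reordered so that the second row, read as (z, w), has the shape
    of a first row in the swapped context.\<close>
  have rec': "z (Suc i) = z i \<otimes>\<^bsub>B\<^esub> b \<oplus>\<^bsub>B\<^esub> \<psi> (pure_tensor A N M (w i) m)"
    "w (Suc i) = z i \<odot>\<^bsub>N\<^esub> n \<oplus>\<^bsub>N\<^esub> w i \<odot>r\<^bsub>N\<^esub> a" for i
    using x car pc[of i] by (simp_all add: rec(3,4) M.B.a_comm N.M.a_comm)
  obtain l where l: "\<forall>i\<ge>l. z i = \<zero>\<^bsub>B\<^esub> \<and> w i = \<zero>\<^bsub>N\<^esub>"
    using swap.row_eventually_zero[where u = z and v = w, OF nil(2) x(4,3,2,1) pc(4,3) rec'] by blast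
  have "?x [^]\<^bsub>R\<^esub> max k l = \<zero>\<^bsub>R\<^esub>"
    using k l p[of "max k l"] by (simp add: p_def morita_ring_simps)
  then show ?thesis using xR unfolding nilpotent_elem_def by blast
qed

section \<open>Diagonal matrices, and passage of strong nil-cleanness between the matrix ring and
  its corners\<close>

lemma morita_minus:
  assumes "a \<in> carrier A" "m \<in> carrier M" "n \<in> carrier N" "b \<in> carrier B"
  shows "\<ominus>\<^bsub>R\<^esub> (a, m, n, b) = (\<ominus>\<^bsub>A\<^esub> a, \<ominus>\<^bsub>M\<^esub> m, \<ominus>\<^bsub>N\<^esub> n, \<ominus>\<^bsub>B\<^esub> b)"
proof -
  interpret R: ring R by (rule ring_morita_ring)
  show ?thesis
    using assms by (intro R.minus_equality)
      (simp_all add: morita_ring_simps M.A.l_neg M.B.l_neg M.M.l_neg N.M.l_neg)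
qed

lemma diagonal_simps:
  assumes "a \<in> carrier A" "b \<in> carrier B"
  shows "(a, \<zero>\<^bsub>M\<^esub>, \<zero>\<^bsub>N\<^esub>, b) \<ominus>\<^bsub>R\<^esub> (a, \<zero>\<^bsub>M\<^esub>, \<zero>\<^bsub>N\<^esub>, b) \<otimes>\<^bsub>R\<^esub> (a, \<zero>\<^bsub>M\<^esub>, \<zero>\<^bsub>N\<^esub>, b)
      = (a \<ominus>\<^bsub>A\<^esub> a \<otimes>\<^bsub>A\<^esub> a, \<zero>\<^bsub>M\<^esub>, \<zero>\<^bsub>N\<^esub>, b \<ominus>\<^bsub>B\<^esub> b \<otimes>\<^bsub>B\<^esub> b)"
    and "(a, \<zero>\<^bsub>M\<^esub>, \<zero>\<^bsub>N\<^esub>, b) [^]\<^bsub>R\<^esub> (k::nat) = (a [^]\<^bsub>A\<^esub> k, \<zero>\<^bsub>M\<^esub>, \<zero>\<^bsub>N\<^esub>, b [^]\<^bsub>B\<^esub> k)"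
proof -
  show "(a, \<zero>\<^bsub>M\<^esub>, \<zero>\<^bsub>N\<^esub>, b) \<ominus>\<^bsub>R\<^esub> (a, \<zero>\<^bsub>M\<^esub>, \<zero>\<^bsub>N\<^esub>, b) \<otimes>\<^bsub>R\<^esub> (a, \<zero>\<^bsub>M\<^esub>, \<zero>\<^bsub>N\<^esub>, b)
      = (a \<ominus>\<^bsub>A\<^esub> a \<otimes>\<^bsub>A\<^esub> a, \<zero>\<^bsub>M\<^esub>, \<zero>\<^bsub>N\<^esub>, b \<ominus>\<^bsub>B\<^esub> b \<otimes>\<^bsub>B\<^esub> b)"
    using assms by (simp add: a_minus_def morita_minus morita_ring_simps MN.form_zero_left NM.form_zero_left)
  show "(a, \<zero>\<^bsub>M\<^esub>, \<zero>\<^bsub>N\<^esub>, b) [^]\<^bsub>R\<^esub> (k::nat) = (a [^]\<^bsub>A\<^esub> k, \<zero>\<^bsub>M\<^esub>, \<zero>\<^bsub>N\<^esub>, b [^]\<^bsub>B\<^esub> k)"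
    using assms by (induction k) (simp_all add: morita_ring_simps MN.form_zero_left NM.form_zero_left)
qed

text \<open>The given idempotent and nilpotent parts are not assumed diagonal. The criterion on r -
  r^2 bypasses them, because this element and its powers are computed entrywise for diagonal
  r.\<close>

lemma strongly_nil_clean_diagonal:
  assumes "a \<in> carrier A" "b \<in> carrier B" "strongly_nil_clean_elem R (a, \<zero>\<^bsub>M\<^esub>, \<zero>\<^bsub>N\<^esub>, b)"
  shows "strongly_nil_clean_elem A a" "strongly_nil_clean_elem B b"
proof -
  interpret R: ring R by (rule ring_morita_ring)
  have "(a, \<zero>\<^bsub>M\<^esub>, \<zero>\<^bsub>N\<^esub>, b) \<in> carrier R" using assms by (simp add: morita_ring_simps)
  then obtain k :: nat where
    "(a \<ominus>\<^bsub>A\<^esub> a \<otimes>\<^bsub>A\<^esub> a, \<zero>\<^bsub>M\<^esub>, \<zero>\<^bsub>N\<^esub>, b \<ominus>\<^bsub>B\<^esub> b \<otimes>\<^bsub>B\<^esub> b) [^]\<^bsub>R\<^esub> k = \<zero>\<^bsub>R\<^esub>"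
    using assms(3) by (auto simp: R.strongly_nil_clean_elem_iff diagonal_simps(1)[OF assms(1,2)] nilpotent_elem_def)
  then have "(a \<ominus>\<^bsub>A\<^esub> a \<otimes>\<^bsub>A\<^esub> a) [^]\<^bsub>A\<^esub> k = \<zero>\<^bsub>A\<^esub>" "(b \<ominus>\<^bsub>B\<^esub> b \<otimes>\<^bsub>B\<^esub> b) [^]\<^bsub>B\<^esub> k = \<zero>\<^bsub>B\<^esub>"
    using assms by (simp_all add: diagonal_simps(2) morita_ring_simps)
  then show "strongly_nil_clean_elem A a" "strongly_nil_clean_elem B b"
    using assms by (auto simp: M.A.strongly_nil_clean_elem_iff M.B.strongly_nil_clean_elem_iff nilpotent_elem_def)
qed

text \<open>Products with zero off-diagonal entries contribute nothing to the diagonal, so the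
  diagonal entries of an inverse matrix invert \<open>a\<close> and \<open>b\<close>.\<close>

lemma diagonal_Units:
  assumes "(a, \<zero>\<^bsub>M\<^esub>, \<zero>\<^bsub>N\<^esub>, b) \<in> Units R"
  shows "a \<in> Units A" "b \<in> Units B"
proof -
  obtain y where y: "y \<in> carrier R" "y \<otimes>\<^bsub>R\<^esub> (a, \<zero>\<^bsub>M\<^esub>, \<zero>\<^bsub>N\<^esub>, b) = \<one>\<^bsub>R\<^esub>"
      "(a, \<zero>\<^bsub>M\<^esub>, \<zero>\<^bsub>N\<^esub>, b) \<otimes>\<^bsub>R\<^esub> y = \<one>\<^bsub>R\<^esub>" "(a, \<zero>\<^bsub>M\<^esub>, \<zero>\<^bsub>N\<^esub>, b) \<in> carrier R"
    using assms by (auto simp: Units_def)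
  then show "a \<in> Units A" "b \<in> Units B"
    by (auto elim!: morita_carrier_E simp: Units_def morita_ring_simps MN.form_zero_left NM.form_zero_left
      MN.form_zero_right NM.form_zero_right)
qed

text \<open>By the criterion it is enough that s = r - r^2 is nilpotent. Modulo the trace ideals its
  diagonal is a - a^2, b - b^2, both nilpotent, so some power of s has its diagonal in those ideals
  and is itself nilpotent.\<close>

lemma strongly_nil_clean_morita_ring:
  assumes nil: "nilpotent_ideal (trace_ideal B M N \<phi>) A" "nilpotent_ideal (trace_ideal A N M \<psi>) B"
    and "strongly_nil_clean_ring A" "strongly_nil_clean_ring B"
  shows "strongly_nil_clean_ring R"
  unfolding strongly_nil_clean_ring_def
proof (intro conjI ring_morita_ring ballI)
  interpret R: ring R by (rule ring_morita_ring)
  let ?T = "trace_ideal B M N \<phi>" and ?T' = "trace_ideal A N M \<psi>"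
  interpret T: ideal ?T A using nil by (simp add: nilpotent_ideal_def)
  interpret T': ideal ?T' B using nil by (simp add: nilpotent_ideal_def)
  fix r assume r: "r \<in> carrier R"
  then obtain a m n b where abmn: "r = (a, m, n, b)" "a \<in> carrier A" "m \<in> carrier M" "n \<in> carrier N" "b \<in> carrier B"
    by (elim morita_carrier_E)
  define a' where "a' = a \<ominus>\<^bsub>A\<^esub> a \<otimes>\<^bsub>A\<^esub> a"
  define b' where "b' = b \<ominus>\<^bsub>B\<^esub> b \<otimes>\<^bsub>B\<^esub> b"
  \<comment> \<open>The products mn and nm enter the diagonal of r^2; \<open>c\<close> and
    \<open>d\<close> are the resulting corrections to a - a^2 and b - b^2.\<close>
  define c where "c = \<ominus>\<^bsub>A\<^esub> \<phi> (pure_tensor B M N m n)"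
  define d where "d = \<ominus>\<^bsub>B\<^esub> \<psi> (pure_tensor A N M n m)"
  have cd: "c \<in> ?T" "d \<in> ?T'"
    unfolding c_def d_def using abmn by (simp_all add: T.a_inv_closed T'.a_inv_closed MN.form_in_trace NM.form_in_trace)
  have car: "a' \<in> carrier A" "b' \<in> carrier B" "c \<in> carrier A" "d \<in> carrier B"
    using abmn cd by (auto simp: a'_def b'_def)
  obtain k l :: nat where kl: "a' [^]\<^bsub>A\<^esub> k = \<zero>\<^bsub>A\<^esub>" "b' [^]\<^bsub>B\<^esub> l = \<zero>\<^bsub>B\<^esub>"
    using assms(3,4) abmn M.A.strongly_nil_clean_elem_iff M.B.strongly_nil_clean_elem_iff
    unfolding strongly_nil_clean_ring_def nilpotent_elem_def a'_def b'_def by metis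
  define s where "s = r \<ominus>\<^bsub>R\<^esub> r \<otimes>\<^bsub>R\<^esub> r"
  have sR: "s \<in> carrier R" using r by (simp add: s_def)
  obtain m' n' where s: "s = (a' \<oplus>\<^bsub>A\<^esub> c, m', n', b' \<oplus>\<^bsub>B\<^esub> d)"
    using abmn by (auto simp: s_def a_minus_def morita_minus morita_ring_simps a'_def b'_def c_def d_def
        M.A.minus_add M.B.minus_add M.A.a_ac M.B.a_ac)
  then have mn': "m' \<in> carrier M" "n' \<in> carrier N" using sR by (auto simp: morita_ring_simps)
  define p where "p i = s [^]\<^bsub>R\<^esub> i" for i :: nat
  define u where "u i = fst (p i)" for i
  define v where "v i = fst (snd (p i))" for i
  define w where "w i = fst (snd (snd (p i)))" for i
  define z where "z i = snd (snd (snd (p i)))" for i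
  have p: "p i = (u i, v i, w i, z i)" for i by (simp add: u_def v_def w_def z_def)
  have "p i \<in> carrier R" for i using sR by (simp add: p_def)
  then have pc: "u i \<in> carrier A" "v i \<in> carrier M" "w i \<in> carrier N" "z i \<in> carrier B" for i
    by (simp_all add: p morita_ring_simps)
  have p0: "u 0 = \<one>\<^bsub>A\<^esub>" "z 0 = \<one>\<^bsub>B\<^esub>" by (simp_all add: u_def z_def p_def morita_ring_simps)
  have pS: "p (Suc i) = p i \<otimes>\<^bsub>R\<^esub> s" for i by (simp add: p_def)
  \<comment> \<open>Everything except the product with \<open>a'\<close> is grouped into one element
    of the trace ideal, as \<open>power_cong_ideal\<close> requires.\<close>
  have "u (Suc i) = u i \<otimes>\<^bsub>A\<^esub> a' \<oplus>\<^bsub>A\<^esub> (u i \<otimes>\<^bsub>A\<^esub> c \<oplus>\<^bsub>A\<^esub> \<phi> (pure_tensor B M N (v i) n'))" for i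
    using pS[of i] pc[of i] car mn' by (simp add: p s morita_ring_simps M.A.r_distr M.A.a_ac)
  moreover have "u i \<otimes>\<^bsub>A\<^esub> c \<oplus>\<^bsub>A\<^esub> \<phi> (pure_tensor B M N (v i) n') \<in> ?T" for i
    using pc[of i] cd mn' by (simp add: T.a_closed T.I_l_closed MN.form_in_trace)
  ultimately have u: "u i \<ominus>\<^bsub>A\<^esub> a' [^]\<^bsub>A\<^esub> i \<in> ?T" for i
    by (intro M.A.power_cong_ideal[of ?T a' u] T.ideal_axioms) (use pc p0 car in blast)+
  have "z (Suc i) = z i \<otimes>\<^bsub>B\<^esub> b' \<oplus>\<^bsub>B\<^esub> (z i \<otimes>\<^bsub>B\<^esub> d \<oplus>\<^bsub>B\<^esub> \<psi> (pure_tensor A N M (w i) m'))" for i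
    using pS[of i] pc[of i] car mn' by (simp add: p s morita_ring_simps M.B.r_distr M.B.a_ac)
  moreover have "z i \<otimes>\<^bsub>B\<^esub> d \<oplus>\<^bsub>B\<^esub> \<psi> (pure_tensor A N M (w i) m') \<in> ?T'" for i
    using pc[of i] cd mn' by (simp add: T'.a_closed T'.I_l_closed NM.form_in_trace)
  ultimately have z: "z i \<ominus>\<^bsub>B\<^esub> b' [^]\<^bsub>B\<^esub> i \<in> ?T'" for i
    by (intro M.B.power_cong_ideal[of ?T' b' z] T'.ideal_axioms) (use pc p0 car in blast)+
  \<comment> \<open>A single exponent annihilating both \<open>a'\<close> and
    \<open>b'\<close>.\<close>
  let ?i = "k + l"
  have "a' [^]\<^bsub>A\<^esub> ?i = \<zero>\<^bsub>A\<^esub>" "b' [^]\<^bsub>B\<^esub> ?i = \<zero>\<^bsub>B\<^esub>"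
    using kl car M.A.nat_pow_mult[of a' k l] M.B.nat_pow_mult[of b' k l] by simp_all
  then have "u ?i \<in> ?T" "z ?i \<in> ?T'"
    using u[of ?i] z[of ?i] pc[of ?i] by (simp_all add: a_minus_def)
  then have "nilpotent_elem R (p ?i)"
    unfolding p using pc by (intro nilpotent_elem_off_diagonal[OF nil])
  then have "nilpotent_elem R s"
    unfolding p_def by (rule R.nilpotent_elem_power[OF sR])
  then show "strongly_nil_clean_elem R r"
    using r R.strongly_nil_clean_elem_iff s_def by simp
qed

end

theorem theorem4p36:
  fixes A :: "('a, 'x) ring_scheme" and B :: "('b, 'y) ring_scheme"
    and M :: "('a, 'b, 'm) bimodule" and N :: "('b, 'a, 'n) bimodule"
    and \<phi> :: "('m \<times> 'n \<Rightarrow>\<^sub>0 int) set \<Rightarrow> 'a" and \<psi> :: "('n \<times> 'm \<Rightarrow>\<^sub>0 int) set \<Rightarrow> 'b"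
  assumes "morita_context A B M N \<phi> \<psi>"
    and "\<one>\<^bsub>A\<^esub> \<noteq> \<zero>\<^bsub>A\<^esub>" and "\<one>\<^bsub>B\<^esub> \<noteq> \<zero>\<^bsub>B\<^esub>"
    and "nilpotent_ideal (trace_ideal B M N \<phi>) A"
    and "nilpotent_ideal (trace_ideal A N M \<psi>) B"
  shows "gsnc_ring (morita_ring A B M N \<phi> \<psi>)
    \<longleftrightarrow> strongly_nil_clean_ring A \<and> strongly_nil_clean_ring B"
proof -
  interpret morita_context A B M N \<phi> \<psi> by fact
  show ?thesis
  proof
    assume gsnc: "gsnc_ring R"
    have "strongly_nil_clean_elem A a" if "a \<in> carrier A" for a
    proof -
      \<comment> \<open>If this matrix were invertible, its corner entry 0 would be a unit of
        \<open>B\<close>, contrary to 1 \<noteq> 0 there.\<close>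
      have "(a, \<zero>\<^bsub>M\<^esub>, \<zero>\<^bsub>N\<^esub>, \<zero>\<^bsub>B\<^esub>) \<in> carrier R - Units R"
        using that diagonal_Units(2) M.B.zero_not_Unit assms(3) by (auto simp: morita_ring_simps)
      then show ?thesis
        using gsnc that strongly_nil_clean_diagonal(1) unfolding gsnc_ring_def by blast
    qed
    moreover have "strongly_nil_clean_elem B b" if "b \<in> carrier B" for b
    proof -
      have "(\<zero>\<^bsub>A\<^esub>, \<zero>\<^bsub>M\<^esub>, \<zero>\<^bsub>N\<^esub>, b) \<in> carrier R - Units R"
        using that diagonal_Units(1) M.A.zero_not_Unit assms(2) by (auto simp: morita_ring_simps)
      then show ?thesis
        using gsnc that strongly_nil_clean_diagonal(2) unfolding gsnc_ring_def by blast
    qed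
    ultimately show "strongly_nil_clean_ring A \<and> strongly_nil_clean_ring B"
      by (simp add: strongly_nil_clean_ring_def M.A.ring_axioms M.B.ring_axioms)
  next
    assume "strongly_nil_clean_ring A \<and> strongly_nil_clean_ring B"
    then have "strongly_nil_clean_ring R"
      using strongly_nil_clean_morita_ring assms(4,5) by blast
    then show "gsnc_ring R"
      by (simp add: gsnc_ring_def strongly_nil_clean_ring_def)
  qed
qed

end
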